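(* For every weak composition $\mathbf b\in\mathbb N^n$, \[ \mathfrak h_{\mathbf b}=\sum_{\mathbf a\in\mathbb N^n}\tilde K_{\mathbf a\mathbf b}\,\kappa_{\mathbf a}, \qquad \tilde K_{\mathbf a\mathbf b}=\big|\{T \text{ reverse SSAF}\mid \mathrm{sh}(T)=\mathbf a,\ \mathrm{wt}(T)=\mathbf b\}\big|. \]
   Context: Fix a positive integer $n$, $[n]=\{1,\dots,n\}$. Weak compositions are elements of $\mathbb N^n$; $x^{\mathbf a}=\prod_i x_i^{\mathbf a_i}$. $h_k(x_1,\dots,x_i)=\sum_{1\le i_1\le\cdots\le i_k\le i}x_{i_1}\cdots x_{i_k}$, and $\mathfrak h_{\mathbf a}=\prod_{i\ge1}h_{\mathbf a_i}(x_1,\dots,x_i)$. Cells are pairs $(c,r)$ (column $c$, row $r$, row 1 at the bottom). The key diagram of $\mathbf a$ is $\mathbb D(\mathbf a)=\{(c,r)\in\mathbb Z_{>0}\times[n]: c\le\mathbf a_r\}$. A filling is a map $T:\mathbb D(\mathbf a)\to[n]$, with shape $\mathrm{sh}(T)=\mathbf a$ and weight $\mathrm{wt}(T)_i=|T^{-1}(i)|$. The augmented filling $\hat T$ on $\hat{\mathbb D}(\mathbf a)=\mathbb D(\mathbf a)\sqcup\{(0,1),\dots,(0,n)\}$ agrees with $T$ on $\mathbb D(\mathbf a)$ and has $\hat T(0,i)=i$ (basement column). Two cells attack each other if they lie in the same column, or in adjacent columns with the left cell strictly higher than the right one; $\hat T$ is non-attacking if no two attacking cells have equal entries. For $u\in\mathbb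 D(\mathbf a)$ let $\mathrm{left}(u)$ be the cell immediately left of $u$ in $\hat{\mathbb D}(\mathbf a)$ and $\mathrm{leg}(u)$ the number of cells weakly right of $u$ in its row; $\mathrm{maj}(\hat T)$ (resp. $\mathrm{comaj}(\hat T)$) is the sum of $\mathrm{leg}(u)$ over $u$ with $\hat T(u)>\hat T(\mathrm{left}(u))$ (resp. $<$). A triple is three cells of $\hat{\mathbb D}(\mathbf a)$ with distinct entries of the form Type I: $(c,r),(c+1,r),(c,s)$ with $r<s$, $\mathbf a_r>\mathbf a_s$; or Type II: $(c+1,r),(c,s),(c+1,s)$ with $r<s$, $\mathbf a_r\le\mathbf a_s$ ($c\ge0$). With $k$ the entry of the left and $i$ the entry of the right of the two cells sharing a row, and $j$ the entry of the third cell, it is a co-inversion triple if $i<j<k$, $j<k<i$ or $k<i<j$, and an inversion triple if $i>j>k$, $j>k>i$ or $k>i>j$. A semi-standard key tableau (SSKT) is a filling with $\hat T$ non-attacking, $\mathrm{maj}(\hat T)=0$ and no co-inversion triples. A reverse semi-skyline augmented filling (reverse SSAF) is a filling with $\hat T$ non-attacking, $\mathrm{comaj}(\hat T)=0$ and no inversion triples. The key polynomial (Demazure character) is $\kappa_{\mathbf a}=\sum x^{\mathrm{wt}(T)}$ over SSKT $T$ of shape $\mathbf a$. *)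

theory Defs
  imports "HOL-Library.Poly_Mapping" "HOL-Library.FuncSet"
begin

section \<open>Polynomials\<close>

text \<open>Polynomials in the variables $x_1, x_2, \ldots$ with integer coefficients: finitely supported
  maps from exponent vectors to \<^typ>\<open>int\<close>, with the convolution product. Every polynomial below
  involves $x_1, \ldots, x_n$ only.\<close>

type_synonym zpoly = "(nat \<Rightarrow>\<^sub>0 nat) \<Rightarrow>\<^sub>0 int"

definition X :: "nat \<Rightarrow> zpoly" where
  "X i = Poly_Mapping.single (Poly_Mapping.single i 1) 1"

text \<open>Elements of $\mathbf N^n$ are functions on \<^typ>\<open>nat\<close> that vanish outside $\{1,\ldots,n\}$, so
  that equality of functions is equality of weak compositions.\<close>

definition weak_compositions :: "nat \<Rightarrow> (nat \<Rightarrow> nat) set" where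
  "weak_compositions n = {a. \<forall>i. i \<notin> {1..n} \<longrightarrow> a i = 0}"

definition x_pow :: "nat \<Rightarrow> (nat \<Rightarrow> nat) \<Rightarrow> zpoly" where
  "x_pow n a = (\<Prod>i\<in>{1..n}. X i ^ a i)"

text \<open>\<open>h_poly k i\<close> is $h_k(x_1,\ldots,x_i)$; the lists are the index sequences
  $i_1 \le \cdots \le i_k$.\<close>

definition h_poly :: "nat \<Rightarrow> nat \<Rightarrow> zpoly" where
  "h_poly k i =
     (\<Sum>js\<in>{js. length js = k \<and> sorted js \<and> set js \<subseteq> {1..i}}. prod_list (map X js))"

definition flagged_h :: "nat \<Rightarrow> (nat \<Rightarrow> nat) \<Rightarrow> zpoly" where
  "flagged_h n a = (\<Prod>i\<in>{1..n}. h_poly (a i) i)"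


section \<open>Key diagrams and fillings\<close>

text \<open>A cell is a pair (column, row).\<close>

type_synonym cell = "nat \<times> nat"

definition key_diagram :: "nat \<Rightarrow> (nat \<Rightarrow> nat) \<Rightarrow> cell set" where
  "key_diagram n a = {(c, r). 1 \<le> c \<and> r \<in> {1..n} \<and> c \<le> a r}"

definition aug_diagram :: "nat \<Rightarrow> (nat \<Rightarrow> nat) \<Rightarrow> cell set" where
  "aug_diagram n a = key_diagram n a \<union> {0} \<times> {1..n}"

text \<open>Extensional functions, so that fillings of a given shape are counted without repetition.\<close>

definition fillings :: "nat \<Rightarrow> (nat \<Rightarrow> nat) \<Rightarrow> (cell \<Rightarrow> nat) set" where
  "fillings n a = (key_diagram n a \<rightarrow>\<^sub>E {1..n})"

definition wt :: "nat \<Rightarrow> (nat \<Rightarrow> nat) \<Rightarrow> (cell \<Rightarrow> nat) \<Rightarrow> nat \<Rightarrow> nat" where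
  "wt n a T = (\<lambda>i. card {u \<in> key_diagram n a. T u = i})"

definition aug :: "(cell \<Rightarrow> nat) \<Rightarrow> cell \<Rightarrow> nat" where
  "aug T = (\<lambda>(c, r). if c = 0 then r else T (c, r))"

fun attacks :: "cell \<Rightarrow> cell \<Rightarrow> bool" where
  "attacks (c, r) (c', r') \<longleftrightarrow>
     (c' = c \<and> r \<noteq> r') \<or> (c' = c + 1 \<and> r > r') \<or> (c = c' + 1 \<and> r' > r)"

definition non_attacking :: "nat \<Rightarrow> (nat \<Rightarrow> nat) \<Rightarrow> (cell \<Rightarrow> nat) \<Rightarrow> bool" where
  "non_attacking n a T \<longleftrightarrow>
     (\<forall>u\<in>aug_diagram n a. \<forall>v\<in>aug_diagram n a. attacks u v \<longrightarrow> aug T u \<noteq> aug T v)"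

text \<open>Only used for cells of the key diagram, whose column is positive.\<close>

definition left_cell :: "cell \<Rightarrow> cell" where
  "left_cell u = (fst u - 1, snd u)"

definition leg :: "nat \<Rightarrow> (nat \<Rightarrow> nat) \<Rightarrow> cell \<Rightarrow> nat" where
  "leg n a u = card {v \<in> key_diagram n a. snd v = snd u \<and> fst u \<le> fst v}"

definition maj :: "nat \<Rightarrow> (nat \<Rightarrow> nat) \<Rightarrow> (cell \<Rightarrow> nat) \<Rightarrow> nat" where
  "maj n a T = (\<Sum>u\<in>{u \<in> key_diagram n a. aug T u > aug T (left_cell u)}. leg n a u)"

definition comaj :: "nat \<Rightarrow> (nat \<Rightarrow> nat) \<Rightarrow> (cell \<Rightarrow> nat) \<Rightarrow> nat" where
  "comaj n a T = (\<Sum>u\<in>{u \<in> key_diagram n a. aug T u < aug T (left_cell u)}. leg n a u)"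


section \<open>Triples\<close>

text \<open>A triple is stored as \<open>(p, q, w)\<close>, where \<open>p\<close> is the left and \<open>q\<close> the right of the two cells
  sharing a row, and \<open>w\<close> is the third cell.\<close>

definition type_I :: "(nat \<Rightarrow> nat) \<Rightarrow> (cell \<times> cell \<times> cell) set" where
  "type_I a = {((c, r), (c + 1, r), (c, s)) | c r s. r < s \<and> a r > a s}"

definition type_II :: "(nat \<Rightarrow> nat) \<Rightarrow> (cell \<times> cell \<times> cell) set" where
  "type_II a = {((c, s), (c + 1, s), (c + 1, r)) | c r s. r < s \<and> a r \<le> a s}"

definition triples ::
  "nat \<Rightarrow> (nat \<Rightarrow> nat) \<Rightarrow> (cell \<Rightarrow> nat) \<Rightarrow> (cell \<times> cell \<times> cell) set" where
  "triples n a T = {(p, q, w). (p, q, w) \<in> type_I a \<union> type_II a \<and> {p, q, w} \<subseteq> aug_diagram n a \<and>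
     aug T p \<noteq> aug T q \<and> aug T p \<noteq> aug T w \<and> aug T q \<noteq> aug T w}"

fun coinversion :: "(cell \<Rightarrow> nat) \<Rightarrow> cell \<times> cell \<times> cell \<Rightarrow> bool" where
  "coinversion T (p, q, w) \<longleftrightarrow>
     (let k = aug T p; i = aug T q; j = aug T w
      in (i < j \<and> j < k) \<or> (j < k \<and> k < i) \<or> (k < i \<and> i < j))"

fun inversion :: "(cell \<Rightarrow> nat) \<Rightarrow> cell \<times> cell \<times> cell \<Rightarrow> bool" where
  "inversion T (p, q, w) \<longleftrightarrow>
     (let k = aug T p; i = aug T q; j = aug T w
      in (i > j \<and> j > k) \<or> (j > k \<and> k > i) \<or> (k > i \<and> i > j))"


section \<open>Tableaux and key polynomials\<close>

definition SSKT :: "nat \<Rightarrow> (nat \<Rightarrow> nat) \<Rightarrow> (cell \<Rightarrow> nat) set" where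
  "SSKT n a = {T \<in> fillings n a. non_attacking n a T \<and> maj n a T = 0 \<and>
     (\<forall>t\<in>triples n a T. \<not> coinversion T t)}"

definition reverse_SSAF :: "nat \<Rightarrow> (nat \<Rightarrow> nat) \<Rightarrow> (cell \<Rightarrow> nat) set" where
  "reverse_SSAF n a = {T \<in> fillings n a. non_attacking n a T \<and> comaj n a T = 0 \<and>
     (\<forall>t\<in>triples n a T. \<not> inversion T t)}"

definition key_poly :: "nat \<Rightarrow> (nat \<Rightarrow> nat) \<Rightarrow> zpoly" where
  "key_poly n a = (\<Sum>T\<in>SSKT n a. x_pow n (wt n a T))"

definition K_tilde :: "nat \<Rightarrow> (nat \<Rightarrow> nat) \<Rightarrow> (nat \<Rightarrow> nat) \<Rightarrow> nat" where
  "K_tilde n a b = card {T \<in> reverse_SSAF n a. wt n a T = b}"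


section \<open>Finiteness of the index sets\<close>

lemma finite_h_index: "finite {js :: nat list. length js = k \<and> sorted js \<and> set js \<subseteq> {1..i}}"
  by (rule finite_subset[OF _ finite_lists_length_eq[of "{1..i}" k]]) auto

lemma finite_key_diagram: "finite (key_diagram n a)"
proof -
  have "key_diagram n a \<subseteq> (\<lambda>(r, c). (c, r)) ` (SIGMA r:{1..n}. {..a r})"
    by (force simp: key_diagram_def)
  then show ?thesis by (rule finite_subset) auto
qed

lemma finite_fillings: "finite (fillings n a)"
  unfolding fillings_def by (intro finite_PiE finite_key_diagram) auto

lemma finite_SSKT: "finite (SSKT n a)"
  by (rule finite_subset[OF _ finite_fillings[of n a]]) (auto simp: SSKT_def)

lemma finite_reverse_SSAF: "finite (reverse_SSAF n a)"
  by (rule finite_subset[OF _ finite_fillings[of n a]]) (auto simp: reverse_SSAF_def)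

end

theory Submission
  imports Defs "HOL-Computational_Algebra.Polynomial"
begin

text \<open>Removing the smallest entry \<open>p\<close> from an SSKT, or the largest entry \<open>q\<close> from a reverse SSAF, leaves a
  tableau of the same kind, and whether the new cells may be glued to a tableau of shape \<open>b\<close> to give
  one of shape \<open>a\<close> depends on \<open>a\<close> and \<open>b\<close> only (\<open>low_removal a b\<close>, \<open>top_addition q b a\<close>). Read a
  shape as a word whose letters are its row lengths. Then adding a strip is a product of operators
  \<open>1 + y u_c\<close> (\<open>u_c\<close> turns the last letter \<open>c\<close> into \<open>c + 1\<close>) and removing one is a product of
  operators \<open>1 + x d_c\<close> (\<open>d_c\<close> turns the first letter \<open>c + 1\<close> into \<open>c\<close>). The operators \<open>u_c\<close> and
  \<open>d_e\<close> commute for \<open>c \<noteq> e\<close>, and \<open>d_c u_c - u_c d_c = Z_{c+1} - Z_c\<close>, where \<open>Z_c\<close> is the projection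
  onto the words without the letter \<open>c\<close>. Telescoping gives \<open>D U = U D / (1 - x y)\<close> for the generating
  functions \<open>U\<close> and \<open>D\<close> of strip additions and removals, on words ending in \<open>0\<close>. Together with
  \<open>h_k(x_p, \<dots>) = h_k(x_{p+1}, \<dots>) + x_p h_{k-1}(x_p, \<dots>)\<close> this yields the Pieri rule
  \<open>h_k(x_1, \<dots>, x_q) \<kappa>_b = \<Sum> \<kappa>_a\<close> (sum over the shapes \<open>a\<close> obtained from \<open>b\<close> by adding a strip
  of size \<open>k\<close>) for \<open>b\<close> supported on \<open>{1..q - 1}\<close>, and iterating it over \<open>q\<close> builds up the
  reverse SSAFs entry by entry.\<close>


section \<open>Raising and lowering operators on words\<close>

text \<open>The word of a shape \<open>w\<close> has the letters \<open>w 0\<close>, ...,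
  \<open>w q\<close>. Position 0 is no row of a diagram and carries the letter 0 for every
  composition. In a word with \<open>w q = 0\<close> and positive \<open>q\<close>, a strip can
  raise only one letter 0, namely the one at \<open>q\<close>, so position 0 stays
  untouched.\<close>

definition rows_of_length :: "nat \<Rightarrow> nat \<Rightarrow> (nat \<Rightarrow> nat) \<Rightarrow> nat set" where
  "rows_of_length q c w = {r. r \<le> q \<and> w r = c}"

lemma finite_rows_of_length [simp]: "finite (rows_of_length q c w)"
  by (rule finite_subset[of _ "{..q}"]) (auto simp: rows_of_length_def)

text \<open>Operators on words act contravariantly on functions of words, so that a composite is read in the
  opposite order; an undefined step contributes \<open>0\<close>.\<close>

definition raise :: "nat \<Rightarrow> nat \<Rightarrow> ((nat \<Rightarrow> nat) \<Rightarrow> 'a) \<Rightarrow> (nat \<Rightarrow> nat) \<Rightarrow> 'a::comm_ring_1" where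
  "raise q c f w = (if rows_of_length q c w = {} then 0 else f (w(Max (rows_of_length q c w) := Suc c)))"

definition lower :: "nat \<Rightarrow> nat \<Rightarrow> ((nat \<Rightarrow> nat) \<Rightarrow> 'a) \<Rightarrow> (nat \<Rightarrow> nat) \<Rightarrow> 'a::comm_ring_1" where
  "lower q c f w =
     (if rows_of_length q (Suc c) w = {} then 0 else f (w(Min (rows_of_length q (Suc c) w) := c)))"

definition avoid :: "nat \<Rightarrow> nat \<Rightarrow> ((nat \<Rightarrow> nat) \<Rightarrow> 'a) \<Rightarrow> (nat \<Rightarrow> nat) \<Rightarrow> 'a::comm_ring_1" where
  "avoid q c f w = (if rows_of_length q c w = {} then f w else 0)"

lemma rows_of_length_upd:
  "r \<le> q \<Longrightarrow> rows_of_length q c (w(r := d)) =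
    (if c = d then insert r (rows_of_length q c w) else rows_of_length q c w - {r})"
  by (auto simp: rows_of_length_def)

lemma Max_rows_of_length:
  "rows_of_length q c w \<noteq> {} \<Longrightarrow> Max (rows_of_length q c w) \<le> q \<and> w (Max (rows_of_length q c w)) = c"
  using Max_in[of "rows_of_length q c w"] by (auto simp: rows_of_length_def)

lemma Min_rows_of_length:
  "rows_of_length q c w \<noteq> {} \<Longrightarrow> Min (rows_of_length q c w) \<le> q \<and> w (Min (rows_of_length q c w)) = c"
  using Min_in[of "rows_of_length q c w"] by (auto simp: rows_of_length_def)

lemma above_Max_rows_of_length:
  assumes "Max (rows_of_length q c w) < s" "s \<le> q"
  shows "w s \<noteq> c"
proof
  assume "w s = c"
  then have "s \<in> rows_of_length q c w" using assms by (simp add: rows_of_length_def)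
  then show False using Max_ge[OF finite_rows_of_length] assms(1) not_le by blast
qed

lemma below_Min_rows_of_length:
  assumes "s < Min (rows_of_length q c w)" "rows_of_length q c w \<noteq> {}"
  shows "w s \<noteq> c"
proof
  assume "w s = c"
  moreover have "s \<le> q" using Min_rows_of_length[OF assms(2)] assms(1) by simp
  ultimately have "s \<in> rows_of_length q c w" by (simp add: rows_of_length_def)
  then show False using Min_le[OF finite_rows_of_length] assms(1) not_le by blast
qed

section \<open>Commutation relations\<close>

lemma Min_Diff_Max:
  fixes S :: "nat set"
  assumes "finite S" "S - {Max S} \<noteq> {}"
  shows "Min (S - {Max S}) = Min S"
proof (rule Min_eqI)
  have "S \<noteq> {}" using assms by auto
  obtain x where x: "x \<in> S" "x \<noteq> Max S" using assms by auto
  then have "Min S < Max S"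
    using assms(1) by (metis Max_ge Min_le le_neq_implies_less le_trans not_le)
  then show "Min S \<in> S - {Max S}" using Min_in[OF assms(1) \<open>S \<noteq> {}\<close>] by auto
qed (use assms in auto)

lemma Max_Diff_Min:
  fixes S :: "nat set"
  assumes "finite S" "S - {Min S} \<noteq> {}"
  shows "Max (S - {Min S}) = Max S"
proof (rule Max_eqI)
  have "S \<noteq> {}" using assms by auto
  obtain x where x: "x \<in> S" "x \<noteq> Min S" using assms by auto
  then have "Min S < Max S"
    using assms(1) by (metis Max_ge Min_le le_neq_implies_less le_trans not_le)
  then show "Max S \<in> S - {Min S}" using Max_in[OF assms(1) \<open>S \<noteq> {}\<close>] by auto
qed (use assms in auto)

text \<open>For distinct \<open>c\<close> and \<open>c'\<close> neither operator creates the letter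
  that the other one moves. They compete only if \<open>c = Suc c'\<close>: then one takes the last
  and the other the first occurrence of the same letter. With two or more occurrences these moves
  are independent; with a single one both composites are undefined.\<close>

lemma raise_lower_commute:
  assumes "c \<noteq> c'"
  shows "raise q c (lower q c' f) w = lower q c' (raise q c f) w"
proof (cases "rows_of_length q c w = {} \<or> rows_of_length q (Suc c') w = {}")
  case True
  then show ?thesis using assms Max_rows_of_length[of q c w] Min_rows_of_length[of q "Suc c'" w]
    by (auto simp: raise_def lower_def rows_of_length_upd)
next
  case False
  define r where "r = Max (rows_of_length q c w)"
  define s where "s = Min (rows_of_length q (Suc c') w)"
  have r: "r \<le> q" "w r = c" and s: "s \<le> q" "w s = Suc c'"
    using Max_rows_of_length[of q c w] Min_rows_of_length[of q "Suc c'" w] False by (auto simp: r_def s_def)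
  have u: "rows_of_length q (Suc c') (w(r := Suc c)) = rows_of_length q (Suc c') w - {r}"
    "rows_of_length q c (w(s := c')) = rows_of_length q c w - {s}"
    using r s assms by (auto simp: rows_of_length_upd)
  show ?thesis
  proof (cases "c = Suc c'")
    case True
    define S where "S = rows_of_length q c w"
    have fS: "finite S" "S \<noteq> {}" using False by (auto simp: S_def)
    have rs: "r = Max S" "s = Min S" using True by (auto simp: r_def s_def S_def)
    have eq: "S - {r} = {} \<longleftrightarrow> S - {s} = {}"
      using fS Max_in[of S] Min_in[of S] unfolding rs
      by (metis Diff_eq_empty_iff insert_Diff insert_not_empty singleton_insert_inj_eq' subset_singletonD Diff_insert_absorb singletonD)
    have u': "rows_of_length q (Suc c') w = S" "c = Suc c'" "Max S = r" "Min S = s"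
      "rows_of_length q (Suc c') (w(r := Suc (Suc c'))) = S - {r}" "rows_of_length q (Suc c') (w(s := c')) = S - {s}"
      using u rs by (auto simp: True S_def)
    show ?thesis
    proof (cases "S - {r} = {}")
      case True
      then show ?thesis using False u' eq by (simp add: raise_def lower_def)
    next
      case F: False
      have "r \<noteq> s"
      proof
        assume "r = s"
        then have "S \<subseteq> {r}" using fS unfolding rs
          by (metis Max_ge Min_le le_antisym singletonI subsetI)
        then show False using F by auto
      qed
      moreover have "Min (S - {r}) = s" "Max (S - {s}) = r"
        using Min_Diff_Max[of S] Max_Diff_Min[of S] F eq fS rs by auto
      ultimately show ?thesis using False u' eq F by (simp add: raise_def lower_def fun_upd_twist)
    qed
  next
    case F: False
    have "r \<noteq> s" using F r s by auto
    moreover have "rows_of_length q (Suc c') w - {r} = rows_of_length q (Suc c') w"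
      "rows_of_length q c w - {s} = rows_of_length q c w" using F r s by (auto simp: rows_of_length_def)
    ultimately show ?thesis using False u
      by (simp add: raise_def lower_def r_def[symmetric] s_def[symmetric] fun_upd_twist)
  qed
qed

text \<open>If both letters occur, the two orders agree: they return to \<open>w\<close> when the
  last \<open>c\<close> precedes the first \<open>Suc c\<close>, and otherwise move exactly these
  two letters. A discrepancy arises only if exactly one of the letters is missing, where one order
  returns to \<open>w\<close> and the other is undefined; the \<open>avoid\<close> terms record
  this.\<close>

lemma raise_lower_commutator:
  "raise q c (lower q c f) w = lower q c (raise q c f) w + (avoid q (Suc c) f w - avoid q c f w)"
proof -
  define S0 where "S0 = rows_of_length q c w"
  define S1 where "S1 = rows_of_length q (Suc c) w"
  define r where "r = Max S0"
  define s where "s = Min S1"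
  have fin: "finite S0" "finite S1" by (auto simp: S0_def S1_def)
  have r: "r \<le> q \<and> w r = c" if "S0 \<noteq> {}"
    using Max_rows_of_length[of q c w] that by (auto simp: r_def S0_def)
  have s: "s \<le> q \<and> w s = Suc c" if "S1 \<noteq> {}"
    using Min_rows_of_length[of q "Suc c" w] that by (auto simp: s_def S1_def)
  have ne: "r \<noteq> s" if "S0 \<noteq> {}" "S1 \<noteq> {}" using r[OF that(1)] s[OF that(2)] by auto
  \<comment> \<open>Position \<open>r\<close> now carries \<open>Suc c\<close>, so the lowering
    undoes the raising exactly when no \<open>Suc c\<close> stands before \<open>r\<close>.\<close>
  have 1: "raise q c (lower q c f) w =
     (if S0 = {} then 0 else if S1 = {} \<or> r < s then f w else f (w(r := Suc c, s := c)))"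
  proof (cases "S0 = {}")
    case False
    define w1 where "w1 = w(r := Suc c)"
    have r': "rows_of_length q (Suc c) w1 = insert r S1" and w: "w1(r := c) = w"
      using r[OF False] by (auto simp: rows_of_length_upd S1_def w1_def)
    have m: "Min (insert r S1) = (if S1 = {} \<or> r < s then r else s)"
      using Min_insert[OF fin(2)] ne[OF False] by (cases "S1 = {}") (auto simp: s_def[symmetric])
    have "raise q c (lower q c f) w = lower q c f w1"
      using False by (simp add: raise_def w1_def S0_def r_def)
    also have "\<dots> = f (w1(Min (insert r S1) := c))" by (simp add: lower_def r')
    finally show ?thesis unfolding m using False w by (simp add: w1_def[symmetric])
  qed (simp add: raise_def S0_def)
  have 2: "lower q c (raise q c f) w =
     (if S1 = {} then 0 else if S0 = {} \<or> r < s then f w else f (w(r := Suc c, s := c)))"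
  proof (cases "S1 = {}")
    case False
    define w1 where "w1 = w(s := c)"
    have r': "rows_of_length q c w1 = insert s S0" and w: "w1(s := Suc c) = w"
      using s[OF False] by (auto simp: rows_of_length_upd S0_def w1_def)
    have m: "Max (insert s S0) = (if S0 = {} \<or> r < s then s else r)"
      using Max_insert[OF fin(1)] ne[OF _ False] by (cases "S0 = {}") (auto simp: r_def[symmetric])
    have "lower q c (raise q c f) w = raise q c f w1"
      using False by (simp add: lower_def w1_def S1_def s_def)
    also have "\<dots> = f (w1(Max (insert s S0) := Suc c))" by (simp add: raise_def r')
    finally show ?thesis unfolding m using False w ne[OF _ False]
      by (cases "S0 = {} \<or> r < s") (auto simp: w1_def fun_upd_twist)
  qed (simp add: lower_def S1_def)
  show ?thesis unfolding 1 2 by (auto simp: avoid_def S0_def[symmetric] S1_def[symmetric])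
qed

lemma avoid_raise:
  "M \<noteq> c \<Longrightarrow> M \<noteq> Suc c \<Longrightarrow> raise q c (avoid q M f) w = avoid q M (raise q c f) w"
  using Max_rows_of_length[of q c w]
  by (auto simp: raise_def avoid_def rows_of_length_upd) (auto simp: rows_of_length_def)

lemma avoid_lower:
  "M \<noteq> c \<Longrightarrow> M \<noteq> Suc c \<Longrightarrow> lower q c (avoid q M f) w = avoid q M (lower q c f) w"
  using Min_rows_of_length[of q "Suc c" w]
  by (auto simp: lower_def avoid_def rows_of_length_upd) (auto simp: rows_of_length_def)

text \<open>Raising needs a letter \<open>c\<close> and produces \<open>Suc c\<close>; lowering does
  the converse. These vanishing products collapse the error terms in
  \<open>raisings_lowerings_Suc\<close> and \<open>raisings_lowerings\<close>.\<close>

lemma avoid_simps: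
  "raise q c (avoid q (Suc c) f) w = 0"
  "lower q c (avoid q c f) w = 0"
  "avoid q (Suc c) (lower q c f) w = 0"
  "avoid q c (raise q c f) w = 0"
  using Min_rows_of_length[of q "Suc c" w] Max_rows_of_length[of q c w]
  by (auto simp: raise_def lower_def avoid_def rows_of_length_upd)

lemma raise_linear:
  "raise q c (\<lambda>w. f w + k * g w) w = raise q c f w + k * raise q c g w"
  by (simp add: raise_def)

lemma lower_linear:
  "lower q c (\<lambda>w. f w + k * g w) w = lower q c f w + k * lower q c g w"
  by (simp add: lower_def)

lemma avoid_linear:
  "avoid q c (\<lambda>w. f w + k * g w) w = avoid q c f w + k * avoid q c g w"
  by (simp add: avoid_def)

text \<open>Only the operators for letters below \<open>N\<close> are multiplied, which keeps the products finite.\<close>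

fun raisings :: "'a::comm_ring_1 \<Rightarrow> nat \<Rightarrow> nat \<Rightarrow> ((nat \<Rightarrow> nat) \<Rightarrow> 'a) \<Rightarrow> (nat \<Rightarrow> nat) \<Rightarrow> 'a" where
  "raisings y q 0 f = f"
| "raisings y q (Suc N) f = raisings y q N (\<lambda>w. f w + y * raise q N f w)"

text \<open>The recursion nests opposite to \<open>raisings\<close>. Started at a word,
  \<open>raisings\<close> runs through increasing letters and \<open>lowerings\<close> through
  decreasing ones, so that one row can pass through several consecutive lengths.\<close>

fun lowerings :: "'a::comm_ring_1 \<Rightarrow> nat \<Rightarrow> nat \<Rightarrow> ((nat \<Rightarrow> nat) \<Rightarrow> 'a) \<Rightarrow> (nat \<Rightarrow> nat) \<Rightarrow> 'a" where
  "lowerings x q 0 f = f"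
| "lowerings x q (Suc N) f = (\<lambda>w. lowerings x q N f w + x * lower q N (lowerings x q N f) w)"

section \<open>Products of operators\<close>

lemma raisings_linear:
  "raisings y q N (\<lambda>w. f w + k * g w) = (\<lambda>w. raisings y q N f w + k * raisings y q N g w)"
proof (induction N arbitrary: f g)
  case (Suc N)
  have "raisings y q (Suc N) (\<lambda>w. f w + k * g w) =
    raisings y q N (\<lambda>w. (f w + y * raise q N f w) + k * (g w + y * raise q N g w))"
    by (simp add: raise_linear algebra_simps)
  then show ?case by (simp only: Suc raisings.simps)
qed simp

lemma lowerings_linear:
  "lowerings x q N (\<lambda>w. f w + k * g w) = (\<lambda>w. lowerings x q N f w + k * lowerings x q N g w)"
  by (induction N) (simp_all add: lower_linear algebra_simps)

lemma raisings_lower: "N \<le> M \<Longrightarrow> raisings y q N (lower q M f) = lower q M (raisings y q N f)"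
proof (induction N arbitrary: f)
  case (Suc N)
  have "(\<lambda>w. lower q M f w + y * raise q N (lower q M f) w) = lower q M (\<lambda>w. f w + y * raise q N f w)"
    using Suc.prems by (auto simp: lower_linear raise_lower_commute)
  then show ?case using Suc by simp
qed simp

lemma lowerings_raise: "N \<le> M \<Longrightarrow> lowerings x q N (raise q M f) = raise q M (lowerings x q N f)"
  by (induction N) (auto simp: raise_linear raise_lower_commute)

lemma raisings_avoid: "N < M \<Longrightarrow> raisings y q N (avoid q M f) = avoid q M (raisings y q N f)"
proof (induction N arbitrary: f)
  case (Suc N)
  have "(\<lambda>w. avoid q M f w + y * raise q N (avoid q M f) w) = avoid q M (\<lambda>w. f w + y * raise q N f w)"
    using Suc.prems by (auto simp: avoid_linear avoid_raise)
  then show ?case using Suc by simp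
qed simp

lemma lowerings_avoid: "N < M \<Longrightarrow> lowerings x q N (avoid q M f) = avoid q M (lowerings x q N f)"
  by (induction N) (auto simp: avoid_linear avoid_lower)

text \<open>With M = \<open>Suc N\<close>, the factors \<open>1 + y u_M\<close> and
  \<open>1 + x d_M\<close> meet in the middle of the product. Exchanging them costs
  \<open>x * y\<close> times the commutator \<open>Z_{M+1} - Z_M\<close>; afterwards each of them
  commutes past the factors for smaller letters of the other kind. The projection \<open>Z_M\<close>
  annihilates the steps for the letter \<open>N\<close> on both sides, so its term shrinks to
  products of length \<open>N\<close>.\<close>

lemma raisings_lowerings_Suc:
  "raisings y q (Suc (Suc N)) (lowerings x q (Suc (Suc N)) f) w =
    (let g = (\<lambda>w. f w + y * raise q (Suc N) f w); K = raisings y q (Suc N) (lowerings x q (Suc N) g)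
     in K w + x * lower q (Suc N) K w)
    + x * y * raisings y q (Suc N) (lowerings x q (Suc N) (avoid q (Suc (Suc N)) f)) w
    - x * y * raisings y q N (lowerings x q N (avoid q (Suc N) f)) w"
proof -
  let ?M = "Suc N"
  define h where "h = lowerings x q ?M f"
  define g where "g = (\<lambda>w. f w + y * raise q ?M f w)"
  define h' where "h' = lowerings x q ?M g"
  have h': "h' = (\<lambda>w. h w + y * raise q ?M h w)"
    by (simp only: h'_def g_def lowerings_linear lowerings_raise h_def order_refl)
  have "(\<lambda>w. (h w + x * lower q ?M h w) + y * raise q ?M (\<lambda>w. h w + x * lower q ?M h w) w)
    = (\<lambda>w. (\<lambda>w. (\<lambda>w. h' w + x * lower q ?M h' w) w + (x * y) * avoid q (Suc ?M) h w) w
        + (- (x * y)) * avoid q ?M h w)"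
    by (rule ext) (simp add: h' raise_linear lower_linear raise_lower_commutator algebra_simps)
  moreover have "raisings y q (Suc ?M) (lowerings x q (Suc ?M) f) =
    raisings y q ?M (\<lambda>w. (h w + x * lower q ?M h w) + y * raise q ?M (\<lambda>w. h w + x * lower q ?M h w) w)"
    unfolding h_def by simp
  ultimately have 1: "raisings y q (Suc ?M) (lowerings x q (Suc ?M) f) w =
    raisings y q ?M h' w + x * lower q ?M (raisings y q ?M h') w
     + x * y * raisings y q ?M (avoid q (Suc ?M) h) w - x * y * raisings y q ?M (avoid q ?M h) w"
    by (simp only: raisings_linear raisings_lower order_refl) (simp add: algebra_simps)
  have 2: "avoid q (Suc ?M) h = lowerings x q ?M (avoid q (Suc ?M) f)"
    unfolding h_def by (simp only: lowerings_avoid lessI)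
  \<comment> \<open>The factor for \<open>N\<close> drops out of \<open>lowerings\<close>: its step
    needs a letter \<open>Suc N\<close>, which \<open>avoid\<close> forbids.\<close>
  have "avoid q ?M h = avoid q ?M (lowerings x q N f)"
    unfolding h_def lowerings.simps by (rule ext) (simp only: avoid_linear avoid_simps, simp)
  then have 3: "avoid q ?M h = lowerings x q N (avoid q ?M f)"
    by (simp only: lowerings_avoid lessI)
  \<comment> \<open>Raising the letter \<open>N\<close> produces \<open>Suc N\<close>, so this
    factor drops out as well.\<close>
  have 4: "raisings y q ?M (avoid q ?M h) = raisings y q N (avoid q ?M h)"
    by (simp add: avoid_simps)
  show ?thesis unfolding Let_def using 1 unfolding 4 unfolding 2 3 h'_def g_def .
qed

text \<open>The negative error in \<open>raisings_lowerings_Suc\<close> cancels the positive one in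
  the induction hypothesis, so only the last projection survives; the first one, onto words without
  the letter 0, vanishes by assumption. Once \<open>N\<close> bounds all letters that occur, the
  last projection acts as the identity, and the error is \<open>x * y\<close> times the left-hand
  product with \<open>N\<close> in place of \<open>Suc N\<close>.\<close>

lemma raisings_lowerings:
  assumes "rows_of_length q 0 w \<noteq> {}"
  shows "raisings y q (Suc N) (lowerings x q (Suc N) f) w =
    lowerings x q (Suc N) (raisings y q (Suc N) f) w
    + x * y * raisings y q N (lowerings x q N (avoid q (Suc N) f)) w"
  using assms
proof (induction N arbitrary: f w)
  case 0
  then have "avoid q 0 f w = 0" by (simp add: avoid_def)
  then show ?case by (simp add: raise_linear lower_linear raise_lower_commutator algebra_simps)
next
  case (Suc N)
  let ?M = "Suc N"
  define g where "g = (\<lambda>w. f w + y * raise q ?M f w)"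
  define K where "K = raisings y q ?M (lowerings x q ?M g)"
  define L where "L = lowerings x q ?M (raisings y q ?M g)"
  define Z where "Z = raisings y q N (lowerings x q N (avoid q ?M g))"
  have K: "K v = L v + x * y * Z v" if "rows_of_length q 0 v \<noteq> {}" for v
    unfolding K_def L_def Z_def using Suc.IH[OF that] .
  have g: "avoid q ?M g = avoid q ?M f"
    unfolding g_def by (rule ext) (simp only: avoid_linear avoid_simps, simp)
  have Z: "lower q ?M Z v = 0" for v
    unfolding Z_def by (simp only: lowerings_avoid raisings_avoid lessI avoid_simps)
  \<comment> \<open>Lowering \<open>Suc ?M\<close> to \<open>?M\<close> leaves every letter 0 in
    place, so the induction hypothesis also applies to the lowered word.\<close>
  have "rows_of_length q (Suc ?M) w \<noteq> {} \<Longrightarrow> rows_of_length q 0 (w(Min (rows_of_length q (Suc ?M) w) := ?M)) \<noteq> {}"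
    using Suc.prems Min_rows_of_length[of q "Suc ?M" w] by (auto simp: rows_of_length_upd) (auto simp: rows_of_length_def)
  then have "lower q ?M K w = lower q ?M (\<lambda>w. L w + x * y * Z w) w"
    by (simp add: lower_def K)
  also have "\<dots> = lower q ?M L w" by (simp only: lower_linear Z) simp
  finally have "K w + x * lower q ?M K w = L w + x * lower q ?M L w + x * y * Z w"
    using K[OF Suc.prems] by simp
  moreover have "lowerings x q (Suc ?M) (raisings y q (Suc ?M) f) w = L w + x * lower q ?M L w"
    by (simp add: L_def g_def)
  moreover have "raisings y q (Suc ?M) (lowerings x q (Suc ?M) f) w =
    K w + x * lower q ?M K w + x * y * raisings y q ?M (lowerings x q ?M (avoid q (Suc ?M) f)) w - x * y * Z w"
    using raisings_lowerings_Suc[of y q N x f w] unfolding Let_def K_def Z_def g unfolding g_def .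
  ultimately show ?case by simp
qed

section \<open>Strips\<close>

text \<open>The disjunction says that the intervals [a r, b r) and [a s, b s] are disjoint. The
  first consists of the lengths at which row \<open>r\<close> is raised, the second of the lengths
  \<open>c\<close> that row \<open>s\<close> has when the operator for \<open>c\<close> acts. So a
  growing row is always the last one of its length.\<close>

definition top_addition :: "nat \<Rightarrow> (nat \<Rightarrow> nat) \<Rightarrow> (nat \<Rightarrow> nat) \<Rightarrow> bool" where
  "top_addition q a b \<longleftrightarrow> (\<forall>r. a r \<le> b r) \<and> (\<forall>r>q. b r = a r) \<and>
     (\<forall>r s. r < s \<longrightarrow> s \<le> q \<longrightarrow> a r < b r \<longrightarrow> b s < a r \<or> b r \<le> a s)"

text \<open>Dually, (b s, a s] and [b r, a r] are disjoint: a shrinking row \<open>s\<close> is at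
  each of its steps the first row of its length.\<close>

definition low_removal :: "(nat \<Rightarrow> nat) \<Rightarrow> (nat \<Rightarrow> nat) \<Rightarrow> bool" where
  "low_removal a b \<longleftrightarrow> (\<forall>r. b r \<le> a r) \<and>
     (\<forall>r s. r < s \<longrightarrow> b s < a s \<longrightarrow> a r \<le> b s \<or> a s < b r)"

definition additions :: "nat \<Rightarrow> nat \<Rightarrow> (nat \<Rightarrow> nat) \<Rightarrow> (nat \<Rightarrow> nat) set" where
  "additions q N a = {b. top_addition q a b \<and> (\<forall>r. a r < b r \<longrightarrow> b r \<le> N)}"

definition removals :: "nat \<Rightarrow> (nat \<Rightarrow> nat) \<Rightarrow> (nat \<Rightarrow> nat) set" where
  "removals N a = {b. low_removal a b \<and> (\<forall>r. b r < a r \<longrightarrow> a r \<le> N)}"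

lemma finite_bounded_funs:
  fixes B :: "nat \<Rightarrow> nat"
  shows "finite {b :: nat \<Rightarrow> nat. (\<forall>r\<le>q. b r \<le> B r) \<and> (\<forall>r>q. b r = a r)}"
proof (rule finite_subset)
  show "{b. (\<forall>r\<le>q. b r \<le> B r) \<and> (\<forall>r>q. b r = a r)}
      \<subseteq> (\<lambda>f r. if r \<le> q then f r else a r) ` (\<Pi>\<^sub>E r\<in>{..q}. {..B r})"
  proof
    fix b assume b: "b \<in> {b. (\<forall>r\<le>q. b r \<le> B r) \<and> (\<forall>r>q. b r = a r)}"
    show "b \<in> (\<lambda>f r. if r \<le> q then f r else a r) ` (\<Pi>\<^sub>E r\<in>{..q}. {..B r})"
      by (rule image_eqI[of _ _ "restrict b {..q}"]) (use b in \<open>auto simp: fun_eq_iff\<close>)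
  qed
qed (auto intro: finite_PiE)

lemma finite_additions: "finite (additions q N a)"
proof (rule finite_subset)
  show "additions q N a \<subseteq> {b. (\<forall>r\<le>q. b r \<le> max N (a r)) \<and> (\<forall>r>q. b r = a r)}"
    unfolding additions_def top_addition_def
    by (auto simp: max_def) (metis le_antisym le_neq_implies_less nat_le_linear order_trans)+
qed (rule finite_bounded_funs)

lemma removals_bounded: "\<forall>r>q. a r = 0 \<Longrightarrow> b \<in> removals N a \<Longrightarrow> \<forall>r>q. b r = 0"
  by (simp add: removals_def low_removal_def) (metis le_zero_eq)

lemma finite_removals:
  assumes "\<forall>r>q. a r = 0"
  shows "finite (removals N a)"
proof (rule finite_subset)
  show "removals N a \<subseteq> {b. (\<forall>r\<le>q. b r \<le> a r) \<and> (\<forall>r>q. b r = 0)}"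
    using removals_bounded[OF assms] by (auto simp: removals_def low_removal_def)
qed (rule finite_bounded_funs)

lemma additions_0: "additions q 0 a = {a}"
  by (auto simp: additions_def top_addition_def fun_eq_iff)
    (metis le_neq_implies_less not_less0 le_zero_eq)

lemma removals_0: "removals 0 a = {a}"
  by (auto simp: removals_def low_removal_def fun_eq_iff)
    (metis le_neq_implies_less not_less0)

section \<open>Strips built one operator at a time\<close>

lemma Max_rows_ofI: "r \<le> q \<Longrightarrow> w r = c \<Longrightarrow> (\<And>s. r < s \<Longrightarrow> s \<le> q \<Longrightarrow> w s \<noteq> c) \<Longrightarrow> Max (rows_of_length q c w) = r"
  by (rule Max_eqI[OF finite_rows_of_length]) (auto simp: rows_of_length_def not_less[symmetric])

lemma additions_extend:
  assumes v: "v \<in> additions q N w" and ne: "rows_of_length q N v \<noteq> {}"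
  shows "v(Max (rows_of_length q N v) := Suc N) \<in> additions q (Suc N) w"
proof -
  define r where "r = Max (rows_of_length q N v)"
  have r: "r \<le> q" "v r = N" using Max_rows_of_length[OF ne] by (auto simp: r_def)
  have above: "v s \<noteq> N" if "r < s" "s \<le> q" for s
    using above_Max_rows_of_length that by (auto simp: r_def)
  have v1: "w s \<le> v s" "s > q \<Longrightarrow> v s = w s" "w s < v s \<Longrightarrow> v s \<le> N" for s
    using v by (auto simp: additions_def top_addition_def)
  have v2: "v s < w r \<or> v r \<le> w s" if "r < s" "s \<le> q" "w r < v r" for r s
    using v that by (auto simp: additions_def top_addition_def)
  define b where "b = v(r := Suc N)"
  have b: "b s = (if s = r then Suc N else v s)" for s by (simp add: b_def)
  have "b s < w r' \<or> b r' \<le> w s" if rs: "r' < s" "s \<le> q" "w r' < b r'" for r' s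
  proof (cases "r' = r")
    case True
    \<comment> \<open>The interval of row \<open>r\<close> gains only the length \<open>N\<close>. A
      row \<open>s\<close> that has grown ends at \<open>N\<close> at the latest, so it could meet
      \<open>N\<close> only by ending there, which the choice of \<open>r\<close> as the last row of
      length \<open>N\<close> excludes.\<close>
    have ns: "v s \<noteq> N" using above rs True by auto
    have "v s < w r \<or> Suc N \<le> w s"
    proof (cases "w r < N")
      case True
      then have "v s < w r \<or> N \<le> w s" using v2[of r s] rs r \<open>r' = r\<close> by auto
      then show ?thesis using v1(1,3)[of s] ns by linarith
    next
      case False
      then have "w r = N" using v1(1)[of r] r by linarith
      then show ?thesis using v1(1,3)[of s] ns by linarith
    qed
    then show ?thesis using True rs by (simp add: b)
  next
    case r': False
    then have w: "w r' < v r'" using rs by (simp add: b)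
    show ?thesis
    proof (cases "s = r")
      case True
      have "v r < w r' \<or> v r' \<le> w r" using v2[of r' r] rs w True by auto
      then show ?thesis using True r' v1(3)[OF w] r w by (auto simp: b)
    next
      case False
      then show ?thesis using v2[of r' s] rs w r' by (simp add: b)
    qed
  qed
  moreover have "w s \<le> b s" "s > q \<Longrightarrow> b s = w s" "w s < b s \<Longrightarrow> b s \<le> Suc N" for s
    using v1[of s] r by (auto simp: b)
  ultimately show ?thesis unfolding b_def r_def additions_def top_addition_def by blast
qed

text \<open>A strip that is not in \<open>additions q N w\<close> has a row that grows to
  \<open>Suc N\<close>. It has only one, since two such rows would both be raised at length
  \<open>N\<close>. Undoing the last step of this row gives \<open>v\<close>.\<close>

lemma additions_restrict:
  assumes b: "b \<in> additions q (Suc N) w" and nb: "b \<notin> additions q N w"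
  obtains v where "v \<in> additions q N w" "rows_of_length q N v \<noteq> {}" "b = v(Max (rows_of_length q N v) := Suc N)"
proof -
  have b1: "w s \<le> b s" "s > q \<Longrightarrow> b s = w s" "w s < b s \<Longrightarrow> b s \<le> Suc N" for s
    using b by (auto simp: additions_def top_addition_def)
  have b2: "b s < w r \<or> b r \<le> w s" if "r < s" "s \<le> q" "w r < b r" for r s
    using b that by (auto simp: additions_def top_addition_def)
  obtain r where r: "w r < b r" "b r = Suc N"
    using nb b by (force simp: additions_def le_Suc_eq)
  have rq: "r \<le> q" using r b1(2)[of r] by (metis less_irrefl not_le)
  have uniq: "b s \<noteq> Suc N" if "w s < b s" "s \<noteq> r" for s
  proof
    assume s: "b s = Suc N"
    have sq: "s \<le> q" using that b1(2)[of s] by (metis less_irrefl not_le)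
    show False
      using b2[of r s] b2[of s r] r rq that s sq by (cases r s rule: linorder_cases) auto
  qed
  define v where "v = b(r := N)"
  have vs: "v s = (if s = r then N else b s)" for s by (simp add: v_def)
  have "v s < w r' \<or> v r' \<le> w s" if rs: "r' < s" "s \<le> q" "w r' < v r'" for r' s
  proof -
    have "w r' < b r'" using rs r by (auto simp: vs split: if_splits)
    then have "b s < w r' \<or> b r' \<le> w s" using b2 rs by auto
    then show ?thesis using r by (auto simp: vs)
  qed
  moreover have "w s \<le> v s" "s > q \<Longrightarrow> v s = w s" "w s < v s \<Longrightarrow> v s \<le> N" for s
    using b1[of s] r rq uniq[of s] by (auto simp: vs le_Suc_eq)
  ultimately have v: "v \<in> additions q N w" unfolding additions_def top_addition_def by blast
  have "Max (rows_of_length q N v) = r"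
  proof (rule Max_rows_ofI)
    fix s assume s: "r < s" "s \<le> q"
    then have "b s < w r \<or> b r \<le> w s" using b2[of r s] r by auto
    then show "v s \<noteq> N" using s r b1(1)[of s] by (auto simp: vs)
  qed (use rq in \<open>auto simp: vs\<close>)
  moreover have "b = v(r := Suc N)" using r by (auto simp: vs)
  moreover have "r \<in> rows_of_length q N v" using rq by (auto simp: rows_of_length_def vs)
  ultimately show ?thesis using that v by blast
qed

text \<open>The operator for the largest letter \<open>N\<close> acts last on the word, so every new
  strip is an old one followed by one raising of its last row of length \<open>N\<close>. The
  exponent of \<open>y\<close> counts added cells.\<close>

lemma raisings_eq_sum:
  "raisings y q N f w = (\<Sum>b\<in>additions q N w. y ^ (sum b {..q} - sum w {..q}) * f b)"
proof (induction N arbitrary: f)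
  case 0
  then show ?case by (simp add: additions_0)
next
  case (Suc N)
  define S where "S = {v \<in> additions q N w. rows_of_length q N v \<noteq> {}}"
  define up where "up v = v(Max (rows_of_length q N v) := Suc N)" for v
  let ?e = "\<lambda>b. sum b {..q} - sum w {..q}"
  have new: "w (Max (rows_of_length q N v)) < Suc N" "Max (rows_of_length q N v) \<le> q" "v (Max (rows_of_length q N v)) = N"
    "sum w {..q} \<le> sum v {..q}" if "v \<in> S" for v
    using that Max_rows_of_length[of q N v]
    by (auto simp: S_def additions_def top_addition_def less_Suc_eq_le intro!: sum_mono) metis
  have eq: "additions q (Suc N) w = additions q N w \<union> up ` S"
  proof (intro equalityI subsetI)
    fix b assume "b \<in> additions q (Suc N) w"
    then show "b \<in> additions q N w \<union> up ` S"
      using additions_restrict[of b q N w] unfolding S_def up_def by blast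
  next
    fix b assume "b \<in> additions q N w \<union> up ` S"
    then show "b \<in> additions q (Suc N) w"
      using additions_extend[of _ q N w] by (force simp: S_def up_def additions_def)
  qed
  have disj: "additions q N w \<inter> up ` S = {}"
  proof -
    have "up v \<notin> additions q N w" if "v \<in> S" for v
      using new[OF that] by (auto simp: additions_def up_def intro!: exI[of _ "Max (rows_of_length q N v)"])
    then show ?thesis by auto
  qed
  have old: "w r < Suc N \<Longrightarrow> v r \<noteq> Suc N" if "v \<in> S" for v r
    using that by (simp add: S_def additions_def) (metis Suc_n_not_le_n)
  \<comment> \<open>The raised row is the only one in \<open>up v\<close> that grew to length
    \<open>Suc N\<close>, so \<open>v\<close> can be recovered.\<close>
  have inj: "inj_on up S"
  proof (rule inj_onI)
    fix v v' assume v: "v \<in> S" "v' \<in> S" "up v = up v'"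
    define r where "r = Max (rows_of_length q N v)"
    define r' where "r' = Max (rows_of_length q N v')"
    have u: "v(r := Suc N) = v'(r' := Suc N)" using v by (simp add: up_def r_def r'_def)
    have "r = r'"
    proof (rule ccontr)
      assume "r \<noteq> r'"
      then have "v' r = Suc N" using u by (metis fun_upd_apply)
      then show False using old[OF v(2), of r] new(1)[OF v(1)] by (simp add: r_def)
    qed
    moreover have "v r = N" "v' r' = N" using new(3) v by (auto simp: r_def r'_def)
    ultimately show "v = v'" using u by (metis fun_upd_triv fun_upd_upd)
  qed
  have e: "?e (up v) = Suc (?e v)" if "v \<in> S" for v
  proof -
    let ?r = "Max (rows_of_length q N v)"
    have "sum (up v) {..q} = Suc N + sum v ({..q} - {?r})"
      using new(2)[OF that] by (subst sum.remove[of _ ?r]) (auto simp: up_def)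
    moreover have "sum v {..q} = N + sum v ({..q} - {?r})"
      using new(2,3)[OF that] by (subst sum.remove[of _ ?r]) auto
    ultimately show ?thesis using new(4)[OF that] by simp
  qed
  have "raisings y q (Suc N) f w =
    (\<Sum>b\<in>additions q N w. y ^ ?e b * f b) + (\<Sum>b\<in>additions q N w. y ^ Suc (?e b) * raise q N f b)"
    by (simp add: Suc sum.distrib algebra_simps)
  also have "(\<Sum>b\<in>additions q N w. y ^ Suc (?e b) * raise q N f b) = (\<Sum>v\<in>S. y ^ Suc (?e v) * f (up v))"
    unfolding S_def raise_def up_def
    by (rule sum.mono_neutral_cong_right) (auto simp: finite_additions)
  also have "\<dots> = (\<Sum>v\<in>S. y ^ ?e (up v) * f (up v))"
    by (intro sum.cong refl) (simp only: e)
  also have "\<dots> = (\<Sum>b\<in>up ` S. y ^ ?e b * f b)"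
    using inj by (simp add: sum.reindex)
  also have "(\<Sum>b\<in>additions q N w. y ^ ?e b * f b) + (\<Sum>b\<in>up ` S. y ^ ?e b * f b)
     = (\<Sum>b\<in>additions q (Suc N) w. y ^ ?e b * f b)"
    unfolding eq using disj finite_additions[of q N w]
    by (intro sum.union_disjoint[symmetric]) (auto simp: S_def)
  finally show ?case .
qed

text \<open>Among the rows of length \<open>Suc N\<close> only the first one, \<open>r\<close>, can
  shrink. Either it keeps its length, or its first step leads to \<open>w(r := N)\<close>, from
  where only rows of length at most \<open>N\<close> shrink.\<close>

lemma removals_lower:
  assumes r: "w r = Suc N" "\<And>s. s < r \<Longrightarrow> w s \<noteq> Suc N"
  shows "removals (Suc N) w = removals N w \<union> removals N (w(r := N))"
    and "removals N w \<inter> removals N (w(r := N)) = {}"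
proof -
  define v where "v = w(r := N)"
  have vs: "v s = (if s = r then N else w s)" for s by (simp add: v_def)
  show "removals N w \<inter> removals N (w(r := N)) = {}"
  proof -
    have "b r = Suc N" if "b \<in> removals N w" for b
      using that r by (simp add: removals_def low_removal_def) (metis le_neq_implies_less not_less_eq_eq order_refl)
    moreover have "b r \<le> N" if "b \<in> removals N v" for b
      using that by (simp add: removals_def low_removal_def vs) (metis)
    ultimately show ?thesis unfolding v_def by fastforce
  qed
  have "b \<in> removals (Suc N) w" if b: "b \<in> removals N v" for b
  proof -
    have b1: "b s \<le> v s" "b s < v s \<Longrightarrow> v s \<le> N" for s
      using b by (auto simp: removals_def low_removal_def)
    have b2: "v s \<le> b s' \<or> v s' < b s" if "s < s'" "b s' < v s'" for s s'
      using b that by (auto simp: removals_def low_removal_def)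
    have "w s \<le> b s' \<or> w s' < b s" if s: "s < s'" "b s' < w s'" for s s'
    proof (cases "s' = r")
      case True
      have ns: "w s \<noteq> Suc N" using r s True by auto
      have vw: "v s = w s" using s True by (simp add: vs)
      show ?thesis
      proof (cases "b r < N")
        case True
        then have "w s \<le> b r \<or> N < b s" using b2[of s r] s \<open>s' = r\<close> vw by (auto simp: vs)
        then show ?thesis using b1[of s] r ns vw \<open>s' = r\<close> by auto
      next
        case False
        then have "b r = N" using b1(1)[of r] by (simp add: vs)
        then show ?thesis using b1[of s] r ns vw \<open>s' = r\<close> by (cases "b s < v s") auto
      qed
    next
      case False
      then have lt: "b s' < v s'" using s by (simp add: vs)
      then have "v s \<le> b s' \<or> v s' < b s" using b2 s by auto
      moreover have "b s' < N" using b1(2)[OF lt] lt by simp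
      ultimately show ?thesis using False b1(1)[of s] by (auto simp: vs split: if_splits)
    qed
    moreover have "b s \<le> w s" "b s < w s \<Longrightarrow> w s \<le> Suc N" for s
      using b1[of s] r by (auto simp: vs split: if_splits)
    ultimately show ?thesis unfolding removals_def low_removal_def by blast
  qed
  moreover have "b \<in> removals N v" if b: "b \<in> removals (Suc N) w" and nb: "b \<notin> removals N w" for b
  proof -
    have b1: "b s \<le> w s" "b s < w s \<Longrightarrow> w s \<le> Suc N" for s
      using b by (auto simp: removals_def low_removal_def)
    have b2: "w s \<le> b s' \<or> w s' < b s" if "s < s'" "b s' < w s'" for s s'
      using b that by (auto simp: removals_def low_removal_def)
    obtain r' where r': "b r' < w r'" "w r' = Suc N"
      using nb b by (force simp: removals_def le_Suc_eq)
    have min: "w s \<noteq> Suc N" if "s < r'" for s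
      using b2[of s r'] that r' b1(1)[of s] by auto
    have [simp]: "r' = r" using min[of r] r r' by (metis linorder_neqE_nat)
    have uniq: "w s \<noteq> Suc N" if "b s < w s" "s \<noteq> r" for s
      using b2[of r s] that r r' b1(1)[of r] min[of s] by (cases s r rule: linorder_cases) auto
    have "v s \<le> b s' \<or> v s' < b s" if s: "s < s'" "b s' < v s'" for s s'
    proof -
      have "b s' < w s'" using s r by (auto simp: vs split: if_splits)
      then have "w s \<le> b s' \<or> w s' < b s" using b2 s by auto
      then show ?thesis using r by (auto simp: vs)
    qed
    moreover have "b s \<le> v s" "b s < v s \<Longrightarrow> v s \<le> N" for s
      using b1[of s] r r' uniq[of s] by (auto simp: vs le_Suc_eq)
    ultimately show ?thesis unfolding removals_def low_removal_def by blast
  qed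
  moreover have "removals N w \<subseteq> removals (Suc N) w" by (auto simp: removals_def)
  ultimately show "removals (Suc N) w = removals N w \<union> removals N (w(r := N))"
    unfolding v_def by blast
qed

lemma removals_Suc_eq:
  assumes "\<forall>r>q. w r = 0" "rows_of_length q (Suc N) w = {}"
  shows "removals (Suc N) w = removals N w"
proof -
  have "w r \<noteq> Suc N" for r using assms by (cases "r \<le> q") (auto simp: rows_of_length_def)
  then show ?thesis by (auto simp: removals_def le_Suc_eq)
qed

text \<open>The operator for the largest letter acts first here, so the induction hypothesis is also
  used at a lowered word. The operators see the rows up to \<open>q\<close> while
  \<open>low_removal\<close> compares all rows; the assumption reconciles the two.\<close>

lemma lowerings_eq_sum:
  assumes "\<forall>r>q. w r = 0"
  shows "lowerings x q N f w = (\<Sum>b\<in>removals N w. x ^ (sum w {..q} - sum b {..q}) * f b)"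
  using assms
proof (induction N arbitrary: w)
  case 0
  then show ?case by (simp add: removals_0)
next
  case (Suc N)
  let ?e = "\<lambda>w b. sum w {..q} - sum b {..q}"
  show ?case
  proof (cases "rows_of_length q (Suc N) w = {}")
    case True
    then show ?thesis using Suc removals_Suc_eq[OF Suc.prems True] by (simp add: lower_def)
  next
    case False
    define r where "r = Min (rows_of_length q (Suc N) w)"
    define v where "v = w(r := N)"
    have r: "r \<le> q" "w r = Suc N" using Min_rows_of_length[OF False] by (auto simp: r_def)
    have below: "w s \<noteq> Suc N" if "s < r" for s
      using below_Min_rows_of_length that False by (auto simp: r_def)
    have v0: "\<forall>r>q. v r = 0" using Suc.prems r by (auto simp: v_def)
    have "sum v {..q} = N + sum w ({..q} - {r})"
      using r by (subst sum.remove[of _ r]) (auto simp: v_def)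
    moreover have "sum w {..q} = Suc N + sum w ({..q} - {r})"
      using r by (subst sum.remove[of _ r]) auto
    moreover have "sum b {..q} \<le> sum v {..q}" if "b \<in> removals N v" for b
      using that by (auto simp: removals_def low_removal_def intro!: sum_mono)
    ultimately have e: "?e w b = Suc (?e v b)" if "b \<in> removals N v" for b
      using that by (simp add: Suc_diff_le)
    have split: "removals (Suc N) w = removals N w \<union> removals N v" "removals N w \<inter> removals N v = {}"
      using removals_lower[of w r N] r(2) below unfolding v_def by blast+
    have "lowerings x q (Suc N) f w = lowerings x q N f w + x * lowerings x q N f v"
      using False by (simp add: lower_def r_def v_def)
    also have "x * lowerings x q N f v = (\<Sum>b\<in>removals N v. x ^ ?e w b * f b)"
      using e by (simp add: Suc.IH[OF v0] sum_distrib_left mult.assoc)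
    also have "lowerings x q N f w + \<dots> = (\<Sum>b\<in>removals (Suc N) w. x ^ ?e w b * f b)"
      unfolding Suc.IH[OF Suc.prems] split(1)
      by (rule sum.union_disjoint[symmetric])
        (simp_all add: split(2) finite_removals[OF Suc.prems] finite_removals[OF v0])
    finally show ?thesis .
  qed
qed

section \<open>Strips of a given size\<close>

definition strips :: "nat \<Rightarrow> nat \<Rightarrow> (nat \<Rightarrow> nat) \<Rightarrow> (nat \<Rightarrow> nat) set" where
  "strips q k a = {b. top_addition q a b \<and> sum b {..q} = sum a {..q} + k}"

lemma part_le_sum: "r \<le> q \<Longrightarrow> (b :: nat \<Rightarrow> nat) r \<le> sum b {..q}"
  by (rule member_le_sum) auto

text \<open>A raised row has at most as many cells as the whole shape, hence at most
  \<open>M\<close>, so the bound in \<open>additions\<close> holds by itself.\<close>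

lemma strips_additions: "sum a {..q} + k \<le> M \<Longrightarrow>
  strips q k a = {b \<in> additions q M a. sum b {..q} - sum a {..q} = k}"
proof -
  assume M: "sum a {..q} + k \<le> M"
  have "b r \<le> M" if "top_addition q a b" "sum b {..q} = sum a {..q} + k" "a r < b r" for b r
  proof -
    have "r \<le> q" using that by (metis top_addition_def less_irrefl not_le)
    then show ?thesis using part_le_sum[of r q b] that M by simp
  qed
  moreover have "sum a {..q} \<le> sum b {..q}" if "top_addition q a b" for b
    using that by (auto simp: top_addition_def intro: sum_mono)
  ultimately show ?thesis by (fastforce simp: strips_def additions_def)
qed

text \<open>Here \<open>monom 1 1\<close> is a polynomial variable y. It marks the number of added
  cells, so a coefficient selects the strips of size \<open>k\<close>.\<close>

lemma coeff_raisings: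
  assumes "sum a {..q} + k \<le> M"
  shows "poly.coeff (raisings (monom 1 1) q M (\<lambda>b. [:g b:]) a) k = (\<Sum>b\<in>strips q k a. g b)"
proof -
  have m: "monom 1 1 ^ e * [:c:] = monom c e" for c :: 'a and e :: nat
    by (simp add: monom_power mult.commute smult_monom)
  show ?thesis
    unfolding raisings_eq_sum m coeff_sum coeff_monom strips_additions[OF assms]
    by (subst sum.inter_filter) (auto simp: finite_additions intro!: sum.cong)
qed

text \<open>The generating function of strip removals; \<open>key_gen_remove_sum\<close> identifies
  it with splitting off the smallest entry of an SSKT.\<close>

definition remove_sum ::
  "'a::comm_ring_1 \<Rightarrow> nat \<Rightarrow> ((nat \<Rightarrow> nat) \<Rightarrow> 'a) \<Rightarrow> (nat \<Rightarrow> nat) \<Rightarrow> 'a" where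
  "remove_sum x q f a = (\<Sum>b\<in>{b. low_removal a b}. x ^ (sum a {..q} - sum b {..q}) * f b)"

lemma removals_eq: "(\<And>r. a r \<le> N) \<Longrightarrow> removals N a = {b. low_removal a b}"
  by (auto simp: removals_def)

lemma lowerings_const:
  assumes "\<forall>r>q. a r = 0" "\<And>r. a r \<le> N"
  shows "lowerings [:x:] q N (\<lambda>b. [:f b:]) a = [:remove_sum x q f a:]"
proof -
  have c: "[:x:] ^ e = [:x ^ e:]" for e by (induction e) (simp_all add: one_pCons)
  have "(\<Sum>b\<in>S. [:g b:]) = [:sum g S:]" for g :: "_ \<Rightarrow> 'a" and S :: "(nat \<Rightarrow> nat) set"
    by (induction S rule: infinite_finite_induct) simp_all
  then show ?thesis
    by (simp add: lowerings_eq_sum[OF assms(1)] removals_eq[OF assms(2)] remove_sum_def c mult.commute)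
qed

text \<open>This is the coefficient of y^(k+1) in \<open>raisings_lowerings\<close>: the factor
  \<open>x * y\<close> of the error term turns strips of size \<open>Suc k\<close> into strips of
  size \<open>k\<close>. The condition \<open>a q = 0\<close> supplies the letter 0 required
  there.\<close>

lemma sum_strips_remove_sum:
  fixes f :: "(nat \<Rightarrow> nat) \<Rightarrow> 'a::comm_ring_1"
  assumes a: "\<forall>r>q. a r = 0" "a q = 0"
  shows "(\<Sum>b\<in>strips q (Suc k) a. remove_sum x q f b) =
    remove_sum x q (\<lambda>b. \<Sum>c\<in>strips q (Suc k) b. f c) a + x * (\<Sum>b\<in>strips q k a. remove_sum x q f b)"
proof -
  \<comment> \<open>\<open>y\<close> is a polynomial variable recording the size of the strip, and \<open>N\<close> is so large that the
    truncation does not affect the coefficients of \<open>y ^ k\<close> and \<open>y ^ Suc k\<close>\<close>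
  define N where "N = sum a {..q} + Suc k"
  let ?Y = "monom (1::'a) 1" and ?F = "\<lambda>b. [:f b:]"
  have le: "a r \<le> N" for r
    using part_le_sum[of r q a] a by (cases "r \<le> q") (auto simp: N_def)
  have add: "b r \<le> M" "r > q \<Longrightarrow> b r = 0" if "b \<in> additions q M a" "N \<le> M" for M b r
    using that a le[of r] by (auto simp: additions_def top_addition_def) (metis le_neq_implies_less order_trans)
  have zero: "rows_of_length q 0 a \<noteq> {}" using a by (auto simp: rows_of_length_def)
  have "raisings ?Y q (Suc N) (lowerings [:x:] q (Suc N) ?F) a
    = raisings ?Y q (Suc N) (\<lambda>b. [:remove_sum x q f b:]) a"
    unfolding raisings_eq_sum
    by (intro sum.cong refl arg_cong2[where f = "(*)"] lowerings_const) (use add in auto)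
  then have 1: "poly.coeff (raisings ?Y q (Suc N) (lowerings [:x:] q (Suc N) ?F) a) (Suc k)
     = (\<Sum>b\<in>strips q (Suc k) a. remove_sum x q f b)"
    by (simp only: coeff_raisings N_def le_SucI order_refl)
  \<comment> \<open>All letters that occur are at most \<open>N\<close>, so the projection onto
    words without \<open>Suc N\<close> acts as the identity.\<close>
  have "lowerings [:x:] q N (avoid q (Suc N) ?F) b = [:remove_sum x q f b:]"
    if b: "b \<in> additions q N a" for b
  proof -
    have b0: "\<forall>r>q. b r = 0" using add[OF b order_refl] by blast
    have "avoid q (Suc N) ?F c = ?F c" if "c \<in> removals N b" for c
    proof -
      have "c r \<le> N" for r
        using that add(1)[OF b order_refl, of r] by (auto simp: removals_def low_removal_def intro: order_trans)
      then have "c r \<noteq> Suc N" for r by (metis not_less_eq_eq order_refl)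
      then have "rows_of_length q (Suc N) c = {}" by (simp add: rows_of_length_def)
      then show ?thesis by (simp add: avoid_def)
    qed
    then have "lowerings [:x:] q N (avoid q (Suc N) ?F) b = lowerings [:x:] q N ?F b"
      by (simp add: lowerings_eq_sum[OF b0])
    then show ?thesis using lowerings_const[OF b0 add(1)[OF b order_refl]] by simp
  qed
  then have eq: "raisings ?Y q N (lowerings [:x:] q N (avoid q (Suc N) ?F)) a
    = raisings ?Y q N (\<lambda>b. [:remove_sum x q f b:]) a"
    unfolding raisings_eq_sum by simp
  have 2: "poly.coeff (raisings ?Y q N (lowerings [:x:] q N (avoid q (Suc N) ?F)) a) k
     = (\<Sum>b\<in>strips q k a. remove_sum x q f b)"
    unfolding eq by (rule coeff_raisings) (simp add: N_def)
  have "poly.coeff (lowerings [:x:] q (Suc N) (raisings ?Y q (Suc N) ?F) a) (Suc k)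
    = (\<Sum>b\<in>{b. low_removal a b}. x ^ (sum a {..q} - sum b {..q}) *
         poly.coeff (raisings ?Y q (Suc N) ?F b) (Suc k))"
  proof -
    have c: "poly.coeff ([:x:] ^ e * p) j = x ^ e * poly.coeff p j" for e p j
      by (induction e) (simp_all add: mult.assoc)
    show ?thesis
      unfolding lowerings_eq_sum[OF a(1)] coeff_sum c
      by (subst removals_eq, rule le_SucI, rule le, rule refl)
  qed
  also have "\<dots> = remove_sum x q (\<lambda>b. \<Sum>c\<in>strips q (Suc k) b. f c) a"
    unfolding remove_sum_def
  proof (intro sum.cong refl arg_cong2[where f = "(*)"] coeff_raisings)
    fix b assume "b \<in> {b. low_removal a b}"
    then have "sum b {..q} \<le> sum a {..q}" by (auto simp: low_removal_def intro: sum_mono)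
    then show "sum b {..q} + Suc k \<le> Suc N" by (simp add: N_def)
  qed
  finally have 3: "poly.coeff (lowerings [:x:] q (Suc N) (raisings ?Y q (Suc N) ?F) a) (Suc k)
    = remove_sum x q (\<lambda>b. \<Sum>c\<in>strips q (Suc k) b. f c) a" .
  have 4: "poly.coeff ([:x:] * ?Y * p) (Suc k) = x * poly.coeff p k" for p
    by (simp add: mult.assoc coeff_monom_mult)
  show ?thesis
    using arg_cong[OF raisings_lowerings[OF zero, of ?Y N "[:x:]" ?F], of "\<lambda>p. poly.coeff p (Suc k)"]
    unfolding coeff_add 1 3 4 2 .
qed

section \<open>The tableau conditions as conditions on pairs of rows\<close>

definition row_entry :: "(cell \<Rightarrow> nat) \<Rightarrow> nat \<Rightarrow> nat \<Rightarrow> nat" where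
  "row_entry T r c = aug T (c, r)"

lemma row_entry_0 [simp]: "row_entry T r 0 = r"
  by (simp add: row_entry_def aug_def)

lemma row_entry_pos: "0 < c \<Longrightarrow> row_entry T r c = T (c, r)"
  by (simp add: row_entry_def aug_def)

lemma mem_key_diagram: "(c, r) \<in> key_diagram n a \<longleftrightarrow> r \<in> {1..n} \<and> 0 < c \<and> c \<le> a r"
  by (auto simp: key_diagram_def)

lemma mem_aug_diagram: "(c, r) \<in> aug_diagram n a \<longleftrightarrow> r \<in> {1..n} \<and> c \<le> a r"
  by (auto simp: aug_diagram_def key_diagram_def)

text \<open>A cell is counted in its own leg, so every summand is positive.\<close>

lemma sum_leg_eq_0:
  "(\<Sum>u\<in>{u \<in> key_diagram n a. P u}. leg n a u) = 0 \<longleftrightarrow> (\<forall>u\<in>key_diagram n a. \<not> P u)"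
proof -
  have "leg n a u \<noteq> 0" if "u \<in> key_diagram n a" for u
    using that finite_key_diagram[of n a] by (simp add: leg_def) (metis order_refl prod.collapse)
  moreover have "finite {u \<in> key_diagram n a. P u}" using finite_key_diagram[of n a] by simp
  ultimately show ?thesis by (simp only: sum_eq_0_iff) blast
qed

lemma ball_key_diagram_rows:
  "(\<forall>u\<in>key_diagram n a. P (aug T u) (aug T (left_cell u))) \<longleftrightarrow>
    (\<forall>r\<in>{1..n}. \<forall>c<a r. P (row_entry T r (Suc c)) (row_entry T r c))" (is "?L \<longleftrightarrow> ?R")
proof
  assume ?L
  show ?R
  proof (intro ballI allI impI)
    fix r c assume "r \<in> {1..n}" "c < a r"
    then have "(Suc c, r) \<in> key_diagram n a" by (simp add: mem_key_diagram)
    then show "P (row_entry T r (Suc c)) (row_entry T r c)" using \<open>?L\<close> by (force simp: row_entry_def left_cell_def)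
  qed
next
  assume R: ?R
  show ?L
  proof
    fix u assume u: "u \<in> key_diagram n a"
    obtain c r where cr: "u = (Suc c, r)" using u by (cases u; cases "fst u") (auto simp: mem_key_diagram)
    then have "r \<in> {1..n}" "c < a r" using u by (auto simp: mem_key_diagram)
    then have "P (row_entry T r (Suc c)) (row_entry T r c)" using R by blast
    then show "P (aug T u) (aug T (left_cell u))" by (simp add: cr row_entry_def left_cell_def)
  qed
qed

lemma non_attacking_iff:
  "non_attacking n a T \<longleftrightarrow> (\<forall>r\<in>{1..n}. \<forall>s\<in>{1..n}. r < s \<longrightarrow>
     (\<forall>c. c \<le> a r \<and> c \<le> a s \<longrightarrow> row_entry T r c \<noteq> row_entry T s c) \<and>
     (\<forall>c. c < a r \<and> c \<le> a s \<longrightarrow> row_entry T s c \<noteq> row_entry T r (Suc c)))" (is "?L \<longleftrightarrow> ?R")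
proof
  assume ?L
  then have *: "attacks (c, r) (c', s) \<Longrightarrow> r \<in> {1..n} \<Longrightarrow> c \<le> a r \<Longrightarrow> s \<in> {1..n} \<Longrightarrow> c' \<le> a s \<Longrightarrow>
      row_entry T r c \<noteq> row_entry T s c'" for c r c' s
    unfolding non_attacking_def row_entry_def using mem_aug_diagram by blast
  show ?R
  proof (intro ballI impI conjI allI)
    fix r s c assume "r \<in> {1..n}" "s \<in> {1..n}" "r < s" "c \<le> a r \<and> c \<le> a s"
    then show "row_entry T r c \<noteq> row_entry T s c" using *[of c r c s] by simp
  next
    fix r s c assume "r \<in> {1..n}" "s \<in> {1..n}" "r < s" "c < a r \<and> c \<le> a s"
    then show "row_entry T s c \<noteq> row_entry T r (Suc c)" using *[of c s "Suc c" r] by simp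
  qed
next
  assume R: ?R
  have R1: "row_entry T r c \<noteq> row_entry T s c"
    if "r \<in> {1..n}" "s \<in> {1..n}" "r < s" "c \<le> a r" "c \<le> a s" for r s c using R that by blast
  have R2: "row_entry T s c \<noteq> row_entry T r (Suc c)"
    if "r \<in> {1..n}" "s \<in> {1..n}" "r < s" "c < a r" "c \<le> a s" for r s c using R that by blast
  show ?L
    unfolding non_attacking_def
  proof (intro ballI impI)
    fix u v assume "u \<in> aug_diagram n a" "v \<in> aug_diagram n a" "attacks u v"
    then obtain c r c' s where uv: "u = (c, r)" "v = (c', s)" "r \<in> {1..n}" "c \<le> a r" "s \<in> {1..n}" "c' \<le> a s"
      "(c' = c \<and> r \<noteq> s) \<or> (c' = Suc c \<and> s < r) \<or> (c = Suc c' \<and> r < s)"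
      by (cases u; cases v) (auto simp: mem_aug_diagram)
    have "row_entry T r c \<noteq> row_entry T s c'"
      using uv(7)
    proof (elim disjE conjE)
      assume "c' = c" "r \<noteq> s"
      then show ?thesis
        using R1[of r s c] R1[of s r c] uv(3-6) by (metis linorder_neqE_nat)
    next
      assume "c' = Suc c" "s < r"
      then show ?thesis using R2[of s r c] uv(3-6) by auto
    next
      assume "c = Suc c'" "r < s"
      then show ?thesis using R2[of r s c'] uv(3-6) by auto
    qed
    then show "aug T u \<noteq> aug T v" using uv by (simp add: row_entry_def)
  qed
qed

text \<open>Since \<open>P\<close> forces distinct entries, the distinctness demanded in
  \<open>triples\<close> is automatic. What remains are the bounds on \<open>c\<close> that place
  all three cells in the diagram.\<close>

lemma no_triples_iff:
  assumes "\<And>p q w. P (p, q, w) \<Longrightarrow> aug T p \<noteq> aug T q \<and> aug T p \<noteq> aug T w \<and> aug T q \<noteq> aug T w"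
  shows "(\<forall>t\<in>triples n a T. \<not> P t) \<longleftrightarrow> (\<forall>r\<in>{1..n}. \<forall>s\<in>{1..n}. r < s \<longrightarrow>
     (a s < a r \<longrightarrow> (\<forall>c\<le>a s. \<not> P ((c, r), (Suc c, r), (c, s)))) \<and>
     (a r \<le> a s \<longrightarrow> (\<forall>c<a r. \<not> P ((c, s), (Suc c, s), (Suc c, r)))))" (is "?L \<longleftrightarrow> ?R")
proof
  assume L: ?L
  have t: "\<not> P (p, q, w)" if "(p, q, w) \<in> type_I a \<union> type_II a" "{p, q, w} \<subseteq> aug_diagram n a" for p q w
    using L assms[of p q w] that unfolding triples_def by blast
  show ?R
  proof (intro ballI impI conjI allI)
    fix r s c assume "r \<in> {1..n}" "s \<in> {1..n}" "r < s" "a s < a r" "c \<le> a s"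
    then show "\<not> P ((c, r), (Suc c, r), (c, s))"
      by (intro t UnI1) (simp_all add: type_I_def mem_aug_diagram)
  next
    fix r s c assume "r \<in> {1..n}" "s \<in> {1..n}" "r < s" "a r \<le> a s" "c < a r"
    then show "\<not> P ((c, s), (Suc c, s), (Suc c, r))"
      by (intro t UnI2) (simp_all add: type_II_def mem_aug_diagram)
  qed
next
  assume R: ?R
  show ?L
  proof
    fix t assume "t \<in> triples n a T"
    then obtain c r s where rs: "r \<in> {1..n}" "s \<in> {1..n}" "r < s" and
      t: "t = ((c, r), (Suc c, r), (c, s)) \<and> a s < a r \<and> c \<le> a s \<or>
        t = ((c, s), (Suc c, s), (Suc c, r)) \<and> a r \<le> a s \<and> c < a r"
    proof -
      obtain p q w where pqw: "t = (p, q, w)" "(p, q, w) \<in> type_I a \<or> (p, q, w) \<in> type_II a"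
        "p \<in> aug_diagram n a" "q \<in> aug_diagram n a" "w \<in> aug_diagram n a"
        using \<open>t \<in> triples n a T\<close> unfolding triples_def by auto
      from pqw(2) show ?thesis
      proof
        assume "(p, q, w) \<in> type_I a"
        then obtain c r s where "p = (c, r)" "q = (Suc c, r)" "w = (c, s)" "r < s" "a s < a r"
          unfolding type_I_def by auto
        then show ?thesis using that[of r s c] pqw by (simp add: mem_aug_diagram)
      next
        assume "(p, q, w) \<in> type_II a"
        then obtain c r s where "p = (c, s)" "q = (Suc c, s)" "w = (Suc c, r)" "r < s" "a r \<le> a s"
          unfolding type_II_def by auto
        then show ?thesis using that[of r s c] pqw by (simp add: mem_aug_diagram)
      qed
    qed
    show "\<not> P t" using t R rs by blast
  qed
qed

text \<open>Here \<open>\<rho>\<close> and \<open>\<sigma>\<close> are the augmented rows \<open>r < s\<close>, with row lengths \<open>k\<close> and \<open>l\<close>. Since the rows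
  are monotone and start at \<open>r < s\<close>, the conditions on attacking cells and on triples in these two
  rows collapse to one condition per column.\<close>

definition key_pair :: "nat \<Rightarrow> nat \<Rightarrow> (nat \<Rightarrow> nat) \<Rightarrow> (nat \<Rightarrow> nat) \<Rightarrow> bool" where
  "key_pair k l \<rho> \<sigma> \<longleftrightarrow> (if k \<le> l then \<forall>c\<le>k. \<rho> c < \<sigma> c else \<forall>c\<le>l. \<sigma> c < \<rho> (Suc c) \<or> \<rho> c < \<sigma> c)"

definition ssaf_pair :: "nat \<Rightarrow> nat \<Rightarrow> (nat \<Rightarrow> nat) \<Rightarrow> (nat \<Rightarrow> nat) \<Rightarrow> bool" where
  "ssaf_pair k l \<rho> \<sigma> \<longleftrightarrow>
     (if k \<le> l then \<forall>c<k. \<rho> (Suc c) < \<sigma> c \<or> \<sigma> (Suc c) < \<rho> (Suc c) else \<forall>c\<le>l. \<rho> (Suc c) < \<sigma> c)"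

text \<open>For \<open>k \<le> l\<close> the inequality \<open>\<rho> c < \<sigma> c\<close>
  propagates from the basement: the next entry of \<rho> is still below \<open>\<sigma> c\<close>,
  and the type II condition keeps it from exceeding the next entry of \<sigma>. For
  \<open>l < k\<close> the attack conditions and the type I condition of each column combine to the
  disjunction.\<close>

lemma key_pair_iff:
  assumes "\<rho> 0 < \<sigma> 0" "\<forall>c<k. \<rho> (Suc c) \<le> \<rho> c" "\<forall>c<l. \<sigma> (Suc c) \<le> \<sigma> c"
  shows "(\<forall>c. c \<le> k \<and> c \<le> l \<longrightarrow> \<rho> c \<noteq> \<sigma> c) \<and> (\<forall>c. c < k \<and> c \<le> l \<longrightarrow> \<sigma> c \<noteq> \<rho> (Suc c)) \<and>
    (l < k \<longrightarrow> (\<forall>c\<le>l. \<not> (\<rho> (Suc c) < \<sigma> c \<and> \<sigma> c < \<rho> c))) \<and>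
    (k \<le> l \<longrightarrow> (\<forall>c<k. \<not> (\<sigma> (Suc c) < \<rho> (Suc c) \<and> \<rho> (Suc c) < \<sigma> c))) \<longleftrightarrow> key_pair k l \<rho> \<sigma>"
proof (cases "k \<le> l")
  case True
  show ?thesis
  proof
    assume L: "(\<forall>c. c \<le> k \<and> c \<le> l \<longrightarrow> \<rho> c \<noteq> \<sigma> c) \<and> (\<forall>c. c < k \<and> c \<le> l \<longrightarrow> \<sigma> c \<noteq> \<rho> (Suc c)) \<and>
      (l < k \<longrightarrow> (\<forall>c\<le>l. \<not> (\<rho> (Suc c) < \<sigma> c \<and> \<sigma> c < \<rho> c))) \<and>
      (k \<le> l \<longrightarrow> (\<forall>c<k. \<not> (\<sigma> (Suc c) < \<rho> (Suc c) \<and> \<rho> (Suc c) < \<sigma> c)))"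
    have "\<rho> c < \<sigma> c" if "c \<le> k" for c
      using that
    proof (induction c)
      case (Suc c)
      then have "\<rho> (Suc c) < \<sigma> c" using assms(2) by (metis Suc_le_lessD le_less_trans less_or_eq_imp_le)
      moreover have "\<rho> (Suc c) \<noteq> \<sigma> (Suc c)" "\<not> (\<sigma> (Suc c) < \<rho> (Suc c) \<and> \<rho> (Suc c) < \<sigma> c)"
        using L True Suc.prems by auto
      ultimately show ?case by linarith
    qed (use assms in simp)
    then show "key_pair k l \<rho> \<sigma>" using True by (simp add: key_pair_def)
  next
    assume "key_pair k l \<rho> \<sigma>"
    then have *: "\<rho> c < \<sigma> c" if "c \<le> k" for c using True that by (simp add: key_pair_def)
    have 1: "\<rho> (Suc c) < \<sigma> c" "\<rho> (Suc c) < \<sigma> (Suc c)" if "c < k" for c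
      using that *[of c] *[of "Suc c"] assms(2) by (force intro: le_less_trans)+
    then show "(\<forall>c. c \<le> k \<and> c \<le> l \<longrightarrow> \<rho> c \<noteq> \<sigma> c) \<and> (\<forall>c. c < k \<and> c \<le> l \<longrightarrow> \<sigma> c \<noteq> \<rho> (Suc c)) \<and>
      (l < k \<longrightarrow> (\<forall>c\<le>l. \<not> (\<rho> (Suc c) < \<sigma> c \<and> \<sigma> c < \<rho> c))) \<and>
      (k \<le> l \<longrightarrow> (\<forall>c<k. \<not> (\<sigma> (Suc c) < \<rho> (Suc c) \<and> \<rho> (Suc c) < \<sigma> c)))"
      by (intro conjI allI impI) (metis True * 1 less_irrefl less_asym leD)+
  qed
next
  case False
  have "\<rho> c \<noteq> \<sigma> c \<and> \<sigma> c \<noteq> \<rho> (Suc c) \<and> \<not> (\<rho> (Suc c) < \<sigma> c \<and> \<sigma> c < \<rho> c) \<longleftrightarrow>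
      \<sigma> c < \<rho> (Suc c) \<or> \<rho> c < \<sigma> c" if "c \<le> l" for c
  proof -
    have "\<rho> (Suc c) \<le> \<rho> c" using assms(2) False that by auto
    then show ?thesis by linarith
  qed
  moreover have "c \<le> k \<and> c \<le> l \<longleftrightarrow> c \<le> l" "c < k \<and> c \<le> l \<longleftrightarrow> c \<le> l" for c using False by auto
  ultimately show ?thesis using False unfolding key_pair_def by (simp, blast)
qed

text \<open>Rows increase now and the two cases swap roles: for \<open>k \<le> l\<close> the
  equivalence is mostly column by column, while for \<open>l < k\<close> the inequality
  \<open>\<rho> (Suc c) < \<sigma> c\<close> propagates from the basement along type I
  triples.\<close>

lemma ssaf_pair_iff:
  assumes "\<rho> 0 < \<sigma> 0" "\<forall>c<k. \<rho> c \<le> \<rho> (Suc c)" "\<forall>c<l. \<sigma> c \<le> \<sigma> (Suc c)"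
  shows "(\<forall>c. c \<le> k \<and> c \<le> l \<longrightarrow> \<rho> c \<noteq> \<sigma> c) \<and> (\<forall>c. c < k \<and> c \<le> l \<longrightarrow> \<sigma> c \<noteq> \<rho> (Suc c)) \<and>
    (l < k \<longrightarrow> (\<forall>c\<le>l. \<not> (\<rho> c < \<sigma> c \<and> \<sigma> c < \<rho> (Suc c)))) \<and>
    (k \<le> l \<longrightarrow> (\<forall>c<k. \<not> (\<sigma> c < \<rho> (Suc c) \<and> \<rho> (Suc c) < \<sigma> (Suc c)))) \<longleftrightarrow> ssaf_pair k l \<rho> \<sigma>"
    (is "?L \<longleftrightarrow> _")
proof (cases "k \<le> l")
  case True
  show ?thesis
  proof
    assume L: ?L
    have "\<rho> (Suc c) < \<sigma> c \<or> \<sigma> (Suc c) < \<rho> (Suc c)" if "c < k" for c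
    proof -
      have "\<rho> (Suc c) \<noteq> \<sigma> (Suc c)" "\<not> (\<sigma> c < \<rho> (Suc c) \<and> \<rho> (Suc c) < \<sigma> (Suc c))" "\<sigma> c \<noteq> \<rho> (Suc c)"
        using L True that by auto
      then show ?thesis by linarith
    qed
    then show "ssaf_pair k l \<rho> \<sigma>" using True by (simp add: ssaf_pair_def)
  next
    assume "ssaf_pair k l \<rho> \<sigma>"
    then have *: "\<rho> (Suc c) < \<sigma> c \<or> \<sigma> (Suc c) < \<rho> (Suc c)" if "c < k" for c
      using True that by (simp add: ssaf_pair_def)
    have 1: "\<rho> (Suc c) \<noteq> \<sigma> (Suc c)" "\<not> (\<sigma> c < \<rho> (Suc c) \<and> \<rho> (Suc c) < \<sigma> (Suc c))" "\<sigma> c \<noteq> \<rho> (Suc c)"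
      if "c < k" for c
    proof -
      have "\<sigma> c \<le> \<sigma> (Suc c)" using assms(3) True that by simp
      then show "\<rho> (Suc c) \<noteq> \<sigma> (Suc c)" "\<not> (\<sigma> c < \<rho> (Suc c) \<and> \<rho> (Suc c) < \<sigma> (Suc c))" "\<sigma> c \<noteq> \<rho> (Suc c)"
        using *[OF that] by linarith+
    qed
    moreover have "\<rho> c \<noteq> \<sigma> c" if "c \<le> k" for c
      using that 1(1) assms(1) by (cases c) auto
    ultimately show ?L using True by auto
  qed
next
  case False
  show ?thesis
  proof
    assume L: ?L
    have "\<rho> (Suc c) < \<sigma> c" if "c \<le> l" for c
      using that
    proof (induction c)
      case 0
      then show ?case using L False assms(1) by (metis le0 linorder_neqE_nat not_le)
    next
      case (Suc c)
      then have "\<rho> (Suc c) < \<sigma> (Suc c)" using assms(3) by (metis Suc_leD Suc_le_lessD less_le_trans)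
      moreover have "\<sigma> (Suc c) \<noteq> \<rho> (Suc (Suc c))"
        "\<not> (\<rho> (Suc c) < \<sigma> (Suc c) \<and> \<sigma> (Suc c) < \<rho> (Suc (Suc c)))"
        using L False Suc.prems by auto
      ultimately show ?case by linarith
    qed
    then show "ssaf_pair k l \<rho> \<sigma>" using False by (simp add: ssaf_pair_def)
  next
    assume "ssaf_pair k l \<rho> \<sigma>"
    then have 1: "\<rho> (Suc c) < \<sigma> c" if "c \<le> l" for c using False that by (simp add: ssaf_pair_def)
    have 2: "\<rho> c < \<sigma> c" if "c \<le> l" for c
    proof -
      have "\<rho> c \<le> \<rho> (Suc c)" using assms(2) False that by auto
      then show ?thesis using 1[OF that] by simp
    qed
    show ?L by (intro conjI allI impI) (metis False 1 2 less_irrefl less_asym)+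
  qed
qed

section \<open>Tableaux described by pairs of rows\<close>

lemma coinversion_distinct:
  "coinversion T (p, q, w) \<Longrightarrow> aug T p \<noteq> aug T q \<and> aug T p \<noteq> aug T w \<and> aug T q \<noteq> aug T w"
  by (auto simp: Let_def)

lemma SSKT_iff:
  "T \<in> SSKT n a \<longleftrightarrow> T \<in> fillings n a \<and>
     (\<forall>r\<in>{1..n}. \<forall>c<a r. row_entry T r (Suc c) \<le> row_entry T r c) \<and>
     (\<forall>r\<in>{1..n}. \<forall>s\<in>{1..n}. r < s \<longrightarrow> key_pair (a r) (a s) (row_entry T r) (row_entry T s))"
proof -
  have maj: "maj n a T = 0 \<longleftrightarrow> (\<forall>r\<in>{1..n}. \<forall>c<a r. row_entry T r (Suc c) \<le> row_entry T r c)"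
    unfolding maj_def sum_leg_eq_0 ball_key_diagram_rows[of n a "\<lambda>x y. \<not> y < x" T] by (simp add: not_less)
  show ?thesis
  proof (cases "\<forall>r\<in>{1..n}. \<forall>c<a r. row_entry T r (Suc c) \<le> row_entry T r c")
    case True
    define A where "A r s \<longleftrightarrow> (\<forall>c. c \<le> a r \<and> c \<le> a s \<longrightarrow> row_entry T r c \<noteq> row_entry T s c) \<and>
       (\<forall>c. c < a r \<and> c \<le> a s \<longrightarrow> row_entry T s c \<noteq> row_entry T r (Suc c))" for r s
    define B where "B r s \<longleftrightarrow>
       (a s < a r \<longrightarrow> (\<forall>c\<le>a s. \<not> (row_entry T r (Suc c) < row_entry T s c \<and> row_entry T s c < row_entry T r c))) \<and>
       (a r \<le> a s \<longrightarrow> (\<forall>c<a r. \<not> (row_entry T s (Suc c) < row_entry T r (Suc c) \<and> row_entry T r (Suc c) < row_entry T s c)))" for r s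
    \<comment> \<open>In a decreasing row the right cell is not larger than the left one, which
      rules out two of the three cyclic orders.\<close>
    have 1: "coinversion T ((c, r), (Suc c, r), w) \<longleftrightarrow> row_entry T r (Suc c) < aug T w \<and> aug T w < row_entry T r c"
      if "r \<in> {1..n}" "c < a r" for r c w
    proof -
      have "row_entry T r (Suc c) \<le> row_entry T r c" using True that by blast
      then show ?thesis by (auto simp: Let_def row_entry_def[symmetric])
    qed
    have tr: "(\<forall>t\<in>triples n a T. \<not> coinversion T t) \<longleftrightarrow>
      (\<forall>r\<in>{1..n}. \<forall>s\<in>{1..n}. r < s \<longrightarrow> B r s)"
      unfolding B_def
      by (subst no_triples_iff, erule coinversion_distinct, intro ball_cong refl imp_cong conj_cong all_cong arg_cong[where f = Not])
        (simp_all add: 1 row_entry_def[symmetric] del: coinversion.simps)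
    have kp: "key_pair (a r) (a s) (row_entry T r) (row_entry T s) \<longleftrightarrow> A r s \<and> B r s"
      if "r \<in> {1..n}" "s \<in> {1..n}" "r < s" for r s
      unfolding A_def B_def using True that by (subst key_pair_iff[symmetric]) auto
    have pairs: "(\<forall>r\<in>{1..n}. \<forall>s\<in>{1..n}. r < s \<longrightarrow> key_pair (a r) (a s) (row_entry T r) (row_entry T s)) \<longleftrightarrow>
      (\<forall>r\<in>{1..n}. \<forall>s\<in>{1..n}. r < s \<longrightarrow> A r s) \<and> (\<forall>r\<in>{1..n}. \<forall>s\<in>{1..n}. r < s \<longrightarrow> B r s)"
      using kp by meson
    have "non_attacking n a T \<longleftrightarrow> (\<forall>r\<in>{1..n}. \<forall>s\<in>{1..n}. r < s \<longrightarrow> A r s)"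
      unfolding A_def by (rule non_attacking_iff)
    then show ?thesis using maj True unfolding SSKT_def mem_Collect_eq tr pairs by simp
  qed (use maj in \<open>auto simp: SSKT_def\<close>)
qed

lemma inversion_distinct:
  "inversion T (p, q, w) \<Longrightarrow> aug T p \<noteq> aug T q \<and> aug T p \<noteq> aug T w \<and> aug T q \<noteq> aug T w"
  by (auto simp: Let_def)

lemma reverse_SSAF_iff:
  "T \<in> reverse_SSAF n a \<longleftrightarrow> T \<in> fillings n a \<and>
     (\<forall>r\<in>{1..n}. \<forall>c<a r. row_entry T r c \<le> row_entry T r (Suc c)) \<and>
     (\<forall>r\<in>{1..n}. \<forall>s\<in>{1..n}. r < s \<longrightarrow> ssaf_pair (a r) (a s) (row_entry T r) (row_entry T s))"
proof -
  have maj: "comaj n a T = 0 \<longleftrightarrow> (\<forall>r\<in>{1..n}. \<forall>c<a r. row_entry T r c \<le> row_entry T r (Suc c))"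
    unfolding comaj_def sum_leg_eq_0 ball_key_diagram_rows[of n a "\<lambda>x y. \<not> x < y" T] by (simp add: not_less)
  show ?thesis
  proof (cases "\<forall>r\<in>{1..n}. \<forall>c<a r. row_entry T r c \<le> row_entry T r (Suc c)")
    case True
    define A where "A r s \<longleftrightarrow> (\<forall>c. c \<le> a r \<and> c \<le> a s \<longrightarrow> row_entry T r c \<noteq> row_entry T s c) \<and>
       (\<forall>c. c < a r \<and> c \<le> a s \<longrightarrow> row_entry T s c \<noteq> row_entry T r (Suc c))" for r s
    define B where "B r s \<longleftrightarrow>
       (a s < a r \<longrightarrow> (\<forall>c\<le>a s. \<not> (row_entry T r c < row_entry T s c \<and> row_entry T s c < row_entry T r (Suc c)))) \<and>
       (a r \<le> a s \<longrightarrow> (\<forall>c<a r. \<not> (row_entry T s c < row_entry T r (Suc c) \<and> row_entry T r (Suc c) < row_entry T s (Suc c))))" for r s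
    \<comment> \<open>In an increasing row only the order left < third < right is possible.\<close>
    have 1: "inversion T ((c, r), (Suc c, r), w) \<longleftrightarrow> row_entry T r c < aug T w \<and> aug T w < row_entry T r (Suc c)"
      if "r \<in> {1..n}" "c < a r" for r c w
    proof -
      have "row_entry T r c \<le> row_entry T r (Suc c)" using True that by blast
      then show ?thesis by (auto simp: Let_def row_entry_def[symmetric])
    qed
    have tr: "(\<forall>t\<in>triples n a T. \<not> inversion T t) \<longleftrightarrow>
      (\<forall>r\<in>{1..n}. \<forall>s\<in>{1..n}. r < s \<longrightarrow> B r s)"
      unfolding B_def
      by (subst no_triples_iff, erule inversion_distinct, intro ball_cong refl imp_cong conj_cong all_cong arg_cong[where f = Not])
        (simp_all add: 1 row_entry_def[symmetric] del: inversion.simps)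
    have kp: "ssaf_pair (a r) (a s) (row_entry T r) (row_entry T s) \<longleftrightarrow> A r s \<and> B r s"
      if "r \<in> {1..n}" "s \<in> {1..n}" "r < s" for r s
      unfolding A_def B_def using True that by (subst ssaf_pair_iff[symmetric]) auto
    have pairs: "(\<forall>r\<in>{1..n}. \<forall>s\<in>{1..n}. r < s \<longrightarrow> ssaf_pair (a r) (a s) (row_entry T r) (row_entry T s)) \<longleftrightarrow>
      (\<forall>r\<in>{1..n}. \<forall>s\<in>{1..n}. r < s \<longrightarrow> A r s) \<and> (\<forall>r\<in>{1..n}. \<forall>s\<in>{1..n}. r < s \<longrightarrow> B r s)"
      using kp by meson
    have "non_attacking n a T \<longleftrightarrow> (\<forall>r\<in>{1..n}. \<forall>s\<in>{1..n}. r < s \<longrightarrow> A r s)"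
      unfolding A_def by (rule non_attacking_iff)
    then show ?thesis using maj True unfolding reverse_SSAF_def mem_Collect_eq tr pairs by simp
  qed (use maj in \<open>auto simp: reverse_SSAF_def\<close>)
qed

section \<open>Removing the extreme entry of a tableau\<close>

lemma key_pair_cong:
  assumes "\<And>c. c \<le> k \<Longrightarrow> \<rho> c = \<rho>' c" "\<And>c. c \<le> l \<Longrightarrow> \<sigma> c = \<sigma>' c"
  shows "key_pair k l \<rho> \<sigma> \<longleftrightarrow> key_pair k l \<rho>' \<sigma>'"
  using assms by (auto simp: key_pair_def)

lemma ssaf_pair_cong:
  assumes "\<And>c. c \<le> k \<Longrightarrow> \<rho> c = \<rho>' c" "\<And>c. c \<le> l \<Longrightarrow> \<sigma> c = \<sigma>' c"
  shows "ssaf_pair k l \<rho> \<sigma> \<longleftrightarrow> ssaf_pair k l \<rho>' \<sigma>'"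
  using assms by (auto simp: ssaf_pair_def)

text \<open>An entry \<open>p\<close> of \<sigma> exceeds no entry of \<rho>. So if \<sigma> ends in
  entries \<open>p\<close>, then either \<rho> stops before them, or \<rho> has entries larger than
  \<open>p\<close> beyond the end of \<sigma>. This is the condition in
  \<open>low_removal\<close>.\<close>

lemma key_pair_removal:
  assumes le: "k' \<le> k" "l' \<le> l" and base: "p \<le> \<rho> 0" "\<rho> 0 < \<sigma> 0"
    and \<rho>: "\<And>c. 0 < c \<Longrightarrow> c \<le> k' \<Longrightarrow> p < \<rho> c" "\<And>c. k' < c \<Longrightarrow> c \<le> k \<Longrightarrow> \<rho> c = p"
    and \<sigma>: "\<And>c. 0 < c \<Longrightarrow> c \<le> l' \<Longrightarrow> p < \<sigma> c" "\<And>c. l' < c \<Longrightarrow> c \<le> l \<Longrightarrow> \<sigma> c = p"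
    and dec: "\<And>c. c < l \<Longrightarrow> \<sigma> (Suc c) \<le> \<sigma> c"
  shows "key_pair k l \<rho> \<sigma> \<longleftrightarrow> key_pair k' l' \<rho> \<sigma> \<and> (l' < l \<longrightarrow> k \<le> l' \<or> l < k')"
proof -
  have \<sigma>p: "p < \<sigma> c" if "c \<le> l'" for c
    using \<sigma>(1)[of c] base that by (cases "c = 0") auto
  have \<rho>p: "p \<le> \<rho> c" if "c \<le> k" for c
    using \<rho>(1)[of c] \<rho>(2)[of c] base that by (cases "c = 0"; cases "c \<le> k'") auto
  show ?thesis
  proof (cases "k \<le> l")
    case True
    show ?thesis
    proof
      assume "key_pair k l \<rho> \<sigma>"
      then have *: "\<rho> c < \<sigma> c" if "c \<le> k" for c using True that by (simp add: key_pair_def)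
      have "k \<le> l'"
      proof (rule ccontr)
        assume "\<not> k \<le> l'"
        then have "\<sigma> k = p" using \<sigma>(2)[of k] True by simp
        then show False using *[of k] \<rho>p[of k] by simp
      qed
      then show "key_pair k' l' \<rho> \<sigma> \<and> (l' < l \<longrightarrow> k \<le> l' \<or> l < k')"
        using * le by (simp add: key_pair_def)
    next
      assume R: "key_pair k' l' \<rho> \<sigma> \<and> (l' < l \<longrightarrow> k \<le> l' \<or> l < k')"
      then have kl: "k \<le> l'" using le True by (cases "l' < l") auto
      have "\<rho> c < \<sigma> c" if "c \<le> k" for c
      proof (cases "c \<le> k'")
        case True
        then show ?thesis using R kl le by (simp add: key_pair_def)
      next
        case False
        then show ?thesis using \<rho>(2)[of c] \<sigma>p[of c] that kl by simp
      qed
      then show "key_pair k l \<rho> \<sigma>" using True by (simp add: key_pair_def)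
    qed
  next
    case False
    have kp: "key_pair k l \<rho> \<sigma> \<longleftrightarrow> (\<forall>c\<le>l. \<sigma> c < \<rho> (Suc c) \<or> \<rho> c < \<sigma> c)"
      using False by (simp add: key_pair_def)
    show ?thesis
    proof (cases "l' < l")
      case True
      show ?thesis
      proof
        assume "key_pair k l \<rho> \<sigma>"
        then have *: "\<sigma> c < \<rho> (Suc c) \<or> \<rho> c < \<sigma> c" if "c \<le> l" for c using kp that by blast
        have "\<not> \<rho> l < \<sigma> l" using \<rho>p[of l] \<sigma>(2)[of l] True False by simp
        then have "p < \<rho> (Suc l)" using *[of l] \<sigma>(2)[of l] True by simp
        then have "l < k'" using \<rho>(2)[of "Suc l"] False by (cases "l < k'") auto
        then show "key_pair k' l' \<rho> \<sigma> \<and> (l' < l \<longrightarrow> k \<le> l' \<or> l < k')"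
          using * True by (simp add: key_pair_def)
      next
        assume R: "key_pair k' l' \<rho> \<sigma> \<and> (l' < l \<longrightarrow> k \<le> l' \<or> l < k')"
        then have kl: "l < k'" using True False by auto
        have "\<sigma> c < \<rho> (Suc c) \<or> \<rho> c < \<sigma> c" if "c \<le> l" for c
        proof (cases "c \<le> l'")
          case c: True
          then show ?thesis using R kl True by (simp add: key_pair_def)
        next
          case c: False
          then show ?thesis using \<sigma>(2)[of c] \<rho>(1)[of "Suc c"] that kl by simp
        qed
        then show "key_pair k l \<rho> \<sigma>" using kp by blast
      qed
    next
      case nl: False
      then have l': "l' = l" using le by simp
      show ?thesis
      proof (cases "k' \<le> l")
        case True
        \<comment> \<open>Only \<rho> is shortened, and \<open>k' \<le> l < k\<close> changes the
          branch of \<open>key_pair\<close>. In column \<open>k'\<close> the next entry of \<rho> is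
          \<open>p\<close>, which forces the second alternative; as \<sigma> decreases, the first
          one is then excluded in all columns further left.\<close>
        have "(\<forall>c\<le>l. \<sigma> c < \<rho> (Suc c) \<or> \<rho> c < \<sigma> c) \<longleftrightarrow> (\<forall>c\<le>k'. \<rho> c < \<sigma> c)"
        proof
          assume *: "\<forall>c\<le>l. \<sigma> c < \<rho> (Suc c) \<or> \<rho> c < \<sigma> c"
          have "c \<le> k' \<Longrightarrow> \<rho> c < \<sigma> c" for c
          proof (induction "k' - c" arbitrary: c)
            case 0
            then have "c = k'" by simp
            then show ?case using *[rule_format, of k'] True \<rho>(2)[of "Suc k'"] \<sigma>p[of k'] False l' by auto
          next
            case (Suc d)
            then have "\<rho> (Suc c) < \<sigma> (Suc c)" by simp
            moreover have "\<sigma> (Suc c) \<le> \<sigma> c" using dec Suc True by simp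
            ultimately show ?case using *[rule_format, of c] Suc.prems True by auto
          qed
          then show "\<forall>c\<le>k'. \<rho> c < \<sigma> c" by blast
        next
          assume *: "\<forall>c\<le>k'. \<rho> c < \<sigma> c"
          have "\<rho> c < \<sigma> c" if "c \<le> l" for c
            using * \<rho>(2)[of c] \<sigma>p[of c] that False l' by (cases "c \<le> k'") auto
          then show "\<forall>c\<le>l. \<sigma> c < \<rho> (Suc c) \<or> \<rho> c < \<sigma> c" by blast
        qed
        then show ?thesis using True l' kp by (simp add: key_pair_def)
      next
        case k': False
        then show ?thesis using kp l' by (simp add: key_pair_def)
      qed
    qed
  qed
qed

text \<open>The mirror image for the maximum \<open>q\<close>. An entry \<open>q\<close> of \<rho>
  is smaller than no entry of \<sigma>, so either \<sigma> ends before the entries \<open>q\<close>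
  of \<rho> matter, or \<sigma> has entries below \<open>q\<close> in all columns of \<rho>. This is
  the condition in \<open>top_addition\<close>.\<close>

lemma ssaf_pair_addition:
  assumes le: "k' \<le> k" "l' \<le> l" and base: "\<rho> 0 < \<sigma> 0" "\<sigma> 0 \<le> q"
    and \<rho>: "\<And>c. 0 < c \<Longrightarrow> c \<le> k' \<Longrightarrow> \<rho> c < q" "\<And>c. k' < c \<Longrightarrow> c \<le> k \<Longrightarrow> \<rho> c = q"
    and \<sigma>: "\<And>c. 0 < c \<Longrightarrow> c \<le> l' \<Longrightarrow> \<sigma> c < q" "\<And>c. l' < c \<Longrightarrow> c \<le> l \<Longrightarrow> \<sigma> c = q"
    and inc: "\<And>c. c < k \<Longrightarrow> \<rho> c \<le> \<rho> (Suc c)"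
  shows "ssaf_pair k l \<rho> \<sigma> \<longleftrightarrow> ssaf_pair k' l' \<rho> \<sigma> \<and> (k' < k \<longrightarrow> l < k' \<or> k \<le> l')"
proof -
  have \<rho>q: "\<rho> c < q" if "c \<le> k'" for c
    using \<rho>(1)[of c] base that by (cases "c = 0") auto
  have \<sigma>q: "\<sigma> c \<le> q" if "c \<le> l" for c
    using \<sigma>(1)[of c] \<sigma>(2)[of c] base that by (cases "c = 0"; cases "c \<le> l'") auto
  show ?thesis
  proof (cases "k \<le> l")
    case False
    show ?thesis
    proof
      assume "ssaf_pair k l \<rho> \<sigma>"
      then have *: "\<rho> (Suc c) < \<sigma> c" if "c \<le> l" for c using False that by (simp add: ssaf_pair_def)
      have "\<rho> (Suc l) < q" using *[of l] \<sigma>q[of l] by simp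
      then have "l < k'" using \<rho>(2)[of "Suc l"] False by (cases "l < k'") auto
      then show "ssaf_pair k' l' \<rho> \<sigma> \<and> (k' < k \<longrightarrow> l < k' \<or> k \<le> l')"
        using * le by (simp add: ssaf_pair_def)
    next
      assume R: "ssaf_pair k' l' \<rho> \<sigma> \<and> (k' < k \<longrightarrow> l < k' \<or> k \<le> l')"
      then have kl: "l < k'" using False le by (cases "k' < k") auto
      have "\<rho> (Suc c) < \<sigma> c" if "c \<le> l" for c
      proof (cases "c \<le> l'")
        case True
        then show ?thesis using R kl le by (simp add: ssaf_pair_def)
      next
        case False
        then show ?thesis using \<sigma>(2)[of c] \<rho>q[of "Suc c"] that kl by simp
      qed
      then show "ssaf_pair k l \<rho> \<sigma>" using False by (simp add: ssaf_pair_def)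
    qed
  next
    case kl: True
    have sp: "ssaf_pair k l \<rho> \<sigma> \<longleftrightarrow> (\<forall>c<k. \<rho> (Suc c) < \<sigma> c \<or> \<sigma> (Suc c) < \<rho> (Suc c))"
      using kl by (simp add: ssaf_pair_def)
    show ?thesis
    proof (cases "k' < k")
      case True
      show ?thesis
      proof
        assume "ssaf_pair k l \<rho> \<sigma>"
        then have *: "\<rho> (Suc c) < \<sigma> c \<or> \<sigma> (Suc c) < \<rho> (Suc c)" if "c < k" for c using sp that by blast
        obtain c where c: "k = Suc c" using True by (cases k) auto
        have "\<rho> k = q" using \<rho>(2)[of k] True by simp
        then have "\<sigma> k < q" using *[of c] \<sigma>q[of c] kl c by auto
        then have "k \<le> l'" using \<sigma>(2)[of k] kl by (metis less_irrefl not_le)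
        then show "ssaf_pair k' l' \<rho> \<sigma> \<and> (k' < k \<longrightarrow> l < k' \<or> k \<le> l')"
          using * True by (simp add: ssaf_pair_def)
      next
        assume R: "ssaf_pair k' l' \<rho> \<sigma> \<and> (k' < k \<longrightarrow> l < k' \<or> k \<le> l')"
        then have kl': "k \<le> l'" using True kl by auto
        have "\<rho> (Suc c) < \<sigma> c \<or> \<sigma> (Suc c) < \<rho> (Suc c)" if "c < k" for c
        proof (cases "c < k'")
          case c: True
          then show ?thesis using R kl' True by (simp add: ssaf_pair_def)
        next
          case False
          then show ?thesis using \<rho>(2)[of "Suc c"] \<sigma>(1)[of "Suc c"] that kl' by simp
        qed
        then show "ssaf_pair k l \<rho> \<sigma>" using sp by blast
      qed
    next
      case False
      then have k': "k' = k" using le by simp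
      show ?thesis
      proof (cases "k \<le> l'")
        case True
        then show ?thesis using k' sp by (simp add: ssaf_pair_def)
      next
        case nl: False
        \<comment> \<open>Shortening \<sigma> to \<open>l' < k\<close> changes the branch of
          \<open>ssaf_pair\<close>. In column \<open>l'\<close> the next entry of \<sigma> is
          \<open>q\<close>, which leaves only the first alternative; it spreads to the left because
          \<rho> increases.\<close>
        have "(\<forall>c<k. \<rho> (Suc c) < \<sigma> c \<or> \<sigma> (Suc c) < \<rho> (Suc c)) \<longleftrightarrow> (\<forall>c\<le>l'. \<rho> (Suc c) < \<sigma> c)"
        proof
          assume *: "\<forall>c<k. \<rho> (Suc c) < \<sigma> c \<or> \<sigma> (Suc c) < \<rho> (Suc c)"
          have "c \<le> l' \<Longrightarrow> \<rho> (Suc c) < \<sigma> c" for c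
          proof (induction "l' - c" arbitrary: c)
            case 0
            then have "c = l'" by simp
            then show ?case
              using *[rule_format, of l'] nl \<sigma>(2)[of "Suc l'"] \<rho>q[of "Suc l'"] kl k' by auto
          next
            case (Suc d)
            then have "\<rho> (Suc (Suc c)) < \<sigma> (Suc c)" by simp
            moreover have "\<rho> (Suc c) \<le> \<rho> (Suc (Suc c))" using inc Suc nl by simp
            ultimately show ?case using *[rule_format, of c] Suc.prems nl by auto
          qed
          then show "\<forall>c\<le>l'. \<rho> (Suc c) < \<sigma> c" by blast
        next
          assume *: "\<forall>c\<le>l'. \<rho> (Suc c) < \<sigma> c"
          have "\<rho> (Suc c) < \<sigma> c" if "c < k" for c
            using * \<sigma>(2)[of c] \<rho>q[of "Suc c"] that kl k' by (cases "c \<le> l'") auto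
          then show "\<forall>c<k. \<rho> (Suc c) < \<sigma> c \<or> \<sigma> (Suc c) < \<rho> (Suc c)" by blast
        qed
        then show ?thesis using nl k' sp by (simp add: ssaf_pair_def)
      qed
    qed
  qed
qed

section \<open>Gluing a constant strip to a tableau\<close>

definition extend ::
  "nat \<Rightarrow> (nat \<Rightarrow> nat) \<Rightarrow> (nat \<Rightarrow> nat) \<Rightarrow> nat \<Rightarrow> (cell \<Rightarrow> nat) \<Rightarrow> cell \<Rightarrow> nat" where
  "extend n a b v T =
     (\<lambda>u. if u \<in> key_diagram n b then T u else if u \<in> key_diagram n a then v else undefined)"

lemma key_diagram_mono: "(\<And>r. b r \<le> a r) \<Longrightarrow> key_diagram n b \<subseteq> key_diagram n a"
  by (auto simp: key_diagram_def intro: order_trans)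

lemma key_diagram_inj:
  assumes "\<And>r. r \<notin> {1..n} \<Longrightarrow> a r = 0" "\<And>r. r \<notin> {1..n} \<Longrightarrow> b r = 0" "key_diagram n a = key_diagram n b"
  shows "a = b"
proof
  fix r
  have "(c, r) \<in> key_diagram n a \<longleftrightarrow> (c, r) \<in> key_diagram n b" for c using assms(3) by simp
  then have "r \<in> {1..n} \<Longrightarrow> 0 < c \<Longrightarrow> c \<le> a r \<longleftrightarrow> c \<le> b r" for c by (auto simp: mem_key_diagram)
  then show "a r = b r" using assms(1,2)[of r] by (cases "r \<in> {1..n}") (metis le0 le_antisym not_gr_zero order_refl)+
qed

text \<open>The assumption says that \<open>P\<close> is inherited by cells further left. Monotone
  rows provide this for the entries above \<open>p\<close> in an SSKT and for those below
  \<open>q\<close> in a reverse SSAF.\<close>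

lemma initial_subdiagram:
  assumes "\<And>c d r. (c, r) \<in> key_diagram n a \<Longrightarrow> P (c, r) \<Longrightarrow> 0 < d \<Longrightarrow> d \<le> c \<Longrightarrow> P (d, r)"
  obtains b where "\<And>r. b r \<le> a r" "key_diagram n b = {u \<in> key_diagram n a. P u}"
proof
  define S where "S r = {c. (c, r) \<in> key_diagram n a \<and> P (c, r)}" for r
  define b where "b r = Max (insert 0 (S r))" for r
  have fin: "finite (S r)" for r
    by (rule finite_subset[of _ "{..a r}"]) (auto simp: S_def mem_key_diagram)
  show "b r \<le> a r" for r
    using fin[of r] by (auto simp: b_def S_def mem_key_diagram)
  have "(c, r) \<in> key_diagram n b \<longleftrightarrow> c \<in> S r" for c r
  proof
    assume *: "(c, r) \<in> key_diagram n b"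
    then have "0 < c" "c \<le> b r" "r \<in> {1..n}" by (auto simp: mem_key_diagram)
    moreover have "b r \<in> insert 0 (S r)" unfolding b_def by (rule Max_in) (use fin in auto)
    ultimately have "b r \<in> S r" by auto
    then show "c \<in> S r" using assms[of "b r" r c] \<open>0 < c\<close> \<open>c \<le> b r\<close>
      by (auto simp: S_def mem_key_diagram)
  next
    assume "c \<in> S r"
    moreover from this have "c \<le> b r" unfolding b_def using fin by simp
    ultimately show "(c, r) \<in> key_diagram n b" by (auto simp: S_def mem_key_diagram)
  qed
  then show "key_diagram n b = {u \<in> key_diagram n a. P u}" by (auto simp: S_def)
qed

text \<open>Both parts can be read off the glued filling: \<open>b\<close> from the cells whose
  entry is not \<open>v\<close>, and \<open>T\<close> as the restriction to them, since it is
  \<open>undefined\<close> elsewhere.\<close>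

lemma extend_bij:
  assumes R: "\<And>b r. b \<in> R \<Longrightarrow> b r \<le> a r" and a: "\<And>r. r \<notin> {1..n} \<Longrightarrow> a r = 0"
    and S': "\<And>b T. b \<in> R \<Longrightarrow> T \<in> S' b \<Longrightarrow> T \<in> fillings n b \<and> (\<forall>u\<in>key_diagram n b. T u \<noteq> v) \<and> extend n a b v T \<in> S"
    and S: "\<And>T. T \<in> S \<Longrightarrow> \<exists>b\<in>R. \<exists>T'\<in>S' b. T = extend n a b v T'"
  shows "bij_betw (\<lambda>(b, T). extend n a b v T) (SIGMA b:R. S' b) S"
proof (rule bij_betw_imageI)
  have diag: "key_diagram n b = {u \<in> key_diagram n a. extend n a b v T u \<noteq> v}"
    if "b \<in> R" "T \<in> S' b" for b T
    using S'[OF that] key_diagram_mono[of b a n, OF R[OF that(1)]] by (auto simp: extend_def)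
  show "inj_on (\<lambda>(b, T). extend n a b v T) (SIGMA b:R. S' b)"
  proof (rule inj_onI, clarify)
    fix b T b' T'
    assume *: "b \<in> R" "T \<in> S' b" "b' \<in> R" "T' \<in> S' b'" "extend n a b v T = extend n a b' v T'"
    have 0: "b r = 0" "b' r = 0" if "r \<notin> {1..n}" for r
      using R[OF *(1), of r] R[OF *(3), of r] a[OF that] by auto
    have bb: "b = b'"
      by (rule key_diagram_inj[of n]) (use 0 diag[OF *(1,2)] diag[OF *(3,4)] *(5) in auto)
    have "T u = T' u" for u
    proof (cases "u \<in> key_diagram n b")
      case True
      then show ?thesis using fun_cong[OF *(5), of u] bb by (simp add: extend_def)
    next
      case False
      then have "T u = undefined" "T' u = undefined"
        using S'[OF *(1,2)] S'[OF *(3,4)] bb unfolding fillings_def by (meson PiE_arb)+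
      then show ?thesis by simp
    qed
    then show "b = b' \<and> T = T'" using bb by auto
  qed
  show "(\<lambda>(b, T). extend n a b v T) ` (SIGMA b:R. S' b) = S"
    using S' S by (auto simp: image_iff)
qed

lemma row_entry_extend:
  assumes "r \<in> {1..n}" "b r \<le> a r"
  shows "c \<le> b r \<Longrightarrow> row_entry (extend n a b v T) r c = row_entry T r c"
    and "b r < c \<Longrightarrow> c \<le> a r \<Longrightarrow> row_entry (extend n a b v T) r c = v"
  using assms by (cases "c = 0"; auto simp: row_entry_pos extend_def mem_key_diagram)+

lemma extend_fillings:
  assumes "v \<in> {1..n}" "T \<in> fillings n b" "\<And>r. b r \<le> a r"
  shows "extend n a b v T \<in> fillings n a"
  using assms key_diagram_mono[of b a n] unfolding fillings_def extend_def
  by (auto simp: PiE_iff extensional_def subset_iff)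

lemma extend_restrict:
  assumes "T \<in> fillings n a" "\<And>r. b r \<le> a r" "\<And>u. u \<in> key_diagram n a \<Longrightarrow> u \<notin> key_diagram n b \<Longrightarrow> T u = v"
  shows "restrict T (key_diagram n b) \<in> fillings n b" "T = extend n a b v (restrict T (key_diagram n b))"
  using assms key_diagram_mono[of b a n] unfolding fillings_def extend_def
  by (auto simp: PiE_iff extensional_def subset_iff fun_eq_iff)

text \<open>The bound concerns diagram cells and not the basement. As rows decrease from their
  basement entry, a nonempty row \<open>r\<close> requires \<open>p \<le> r\<close>.\<close>

definition SSKT_ge :: "nat \<Rightarrow> nat \<Rightarrow> (nat \<Rightarrow> nat) \<Rightarrow> (cell \<Rightarrow> nat) set" where
  "SSKT_ge p n a = {T \<in> SSKT n a. \<forall>u\<in>key_diagram n a. p \<le> T u}"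

definition reverse_SSAF_le :: "nat \<Rightarrow> nat \<Rightarrow> (nat \<Rightarrow> nat) \<Rightarrow> (cell \<Rightarrow> nat) set" where
  "reverse_SSAF_le q n a = {T \<in> reverse_SSAF n a. \<forall>u\<in>key_diagram n a. T u \<le> q}"

text \<open>A row stays decreasing when entries \<open>p\<close> are appended, because a row that
  receives any has basement entry at least \<open>p\<close>. For pairs of rows,
  \<open>key_pair_removal\<close> separates off a condition on the shapes alone.\<close>

lemma extend_SSKT_ge:
  assumes p: "p \<in> {1..n}" and a: "\<And>r. r \<notin> {p..n} \<Longrightarrow> a r = 0" and ba: "\<And>r. b r \<le> a r"
    and T: "T \<in> fillings n b" "\<forall>u\<in>key_diagram n b. Suc p \<le> T u"
  shows "extend n a b p T \<in> SSKT_ge p n a \<longleftrightarrow> T \<in> SSKT_ge (Suc p) n b \<and> low_removal a b"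
proof -
  let ?E = "extend n a b p T"
  have E: "c \<le> b r \<Longrightarrow> row_entry ?E r c = row_entry T r c" "b r < c \<Longrightarrow> c \<le> a r \<Longrightarrow> row_entry ?E r c = p"
    if "r \<in> {1..n}" for c r using row_entry_extend[of r n b a c p T] that ba by auto
  have big: "p < row_entry T r c" if "r \<in> {1..n}" "0 < c" "c \<le> b r" for r c
    using bspec[OF T(2), of "(c, r)"] that by (simp add: row_entry_pos mem_key_diagram)
  have rows: "(\<forall>c<a r. row_entry ?E r (Suc c) \<le> row_entry ?E r c) \<longleftrightarrow> (\<forall>c<b r. row_entry T r (Suc c) \<le> row_entry T r c)"
    if r: "r \<in> {1..n}" for r
  proof
    assume *: "\<forall>c<a r. row_entry ?E r (Suc c) \<le> row_entry ?E r c"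
    show "\<forall>c<b r. row_entry T r (Suc c) \<le> row_entry T r c"
    proof (intro allI impI)
      fix c assume "c < b r"
      then show "row_entry T r (Suc c) \<le> row_entry T r c"
        using *[rule_format, of c] E(1)[OF r, of c] E(1)[OF r, of "Suc c"] ba[of r] by simp
    qed
  next
    assume *: "\<forall>c<b r. row_entry T r (Suc c) \<le> row_entry T r c"
    show "\<forall>c<a r. row_entry ?E r (Suc c) \<le> row_entry ?E r c"
    proof (intro allI impI)
      fix c assume c: "c < a r"
      then have "p \<le> r" using a[of r] by (cases "p \<le> r") auto
      consider "c < b r" | "c = b r" | "b r < c" by linarith
      then show "row_entry ?E r (Suc c) \<le> row_entry ?E r c"
      proof cases
        case 1
        then show ?thesis using *[rule_format, of c] E(1)[OF r, of c] E(1)[OF r, of "Suc c"] by simp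
      next
        case 2
        have "p \<le> row_entry T r c" using big[OF r, of c] 2 \<open>p \<le> r\<close> by (cases "c = 0") auto
        then show ?thesis using E(1)[OF r, of c] E(2)[OF r, of "Suc c"] 2 c by simp
      next
        case 3
        then show ?thesis using E(2)[OF r, of c] E(2)[OF r, of "Suc c"] c by simp
      qed
    qed
  qed
  have pair: "key_pair (a r) (a s) (row_entry ?E r) (row_entry ?E s) \<longleftrightarrow>
      key_pair (b r) (b s) (row_entry T r) (row_entry T s) \<and> (b s < a s \<longrightarrow> a r \<le> b s \<or> a s < b r)"
    if rs: "r \<in> {1..n}" "s \<in> {1..n}" "r < s" and dec: "\<forall>c<a s. row_entry ?E s (Suc c) \<le> row_entry ?E s c" for r s
  proof (cases "r < p")
    case True
    then have "a r = 0" "b r = 0" using a[of r] ba[of r] by auto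
    then show ?thesis using rs by (simp add: key_pair_def)
  next
    case False
    have "key_pair (a r) (a s) (row_entry ?E r) (row_entry ?E s) \<longleftrightarrow>
      key_pair (b r) (b s) (row_entry ?E r) (row_entry ?E s) \<and> (b s < a s \<longrightarrow> a r \<le> b s \<or> a s < b r)"
      by (rule key_pair_removal[where p = p])
        (use ba rs E big dec False in auto)
    also have "key_pair (b r) (b s) (row_entry ?E r) (row_entry ?E s) \<longleftrightarrow> key_pair (b r) (b s) (row_entry T r) (row_entry T s)"
      by (rule key_pair_cong) (use E rs in auto)
    finally show ?thesis .
  qed
  have rem: "low_removal a b \<longleftrightarrow> (\<forall>r\<in>{1..n}. \<forall>s\<in>{1..n}. r < s \<longrightarrow> b s < a s \<longrightarrow> a r \<le> b s \<or> a s < b r)"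
  proof -
    have "a r \<le> b s \<or> a s < b r" if "r \<notin> {1..n} \<or> s \<notin> {1..n}" "r < s" "b s < a s" for r s
    proof -
      have "s \<in> {p..n}" using that(3) a[of s] by (cases "s \<in> {p..n}") auto
      then have "r \<notin> {p..n}" using that p by auto
      then show ?thesis using a by simp
    qed
    then show ?thesis using ba unfolding low_removal_def by blast
  qed
  have fill: "?E \<in> fillings n a" using p T ba by (intro extend_fillings) auto
  have bound: "\<forall>u\<in>key_diagram n a. p \<le> ?E u" using T(2) by (auto simp: extend_def)
  define A where "A r \<longleftrightarrow> (\<forall>c<b r. row_entry T r (Suc c) \<le> row_entry T r c)" for r
  define B where "B r s \<longleftrightarrow> key_pair (b r) (b s) (row_entry T r) (row_entry T s)" for r s
  define C where "C r s \<longleftrightarrow> (b s < a s \<longrightarrow> a r \<le> b s \<or> a s < b r)" for r s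
  have rowsA: "(\<forall>r\<in>{1..n}. \<forall>c<a r. row_entry ?E r (Suc c) \<le> row_entry ?E r c) \<longleftrightarrow> (\<forall>r\<in>{1..n}. A r)"
    unfolding A_def using rows by blast
  have pairs: "(\<forall>r\<in>{1..n}. \<forall>s\<in>{1..n}. r < s \<longrightarrow> key_pair (a r) (a s) (row_entry ?E r) (row_entry ?E s)) \<longleftrightarrow>
    (\<forall>r\<in>{1..n}. \<forall>s\<in>{1..n}. r < s \<longrightarrow> B r s) \<and> (\<forall>r\<in>{1..n}. \<forall>s\<in>{1..n}. r < s \<longrightarrow> C r s)"
    if "\<forall>r\<in>{1..n}. A r"
  proof -
    have "key_pair (a r) (a s) (row_entry ?E r) (row_entry ?E s) \<longleftrightarrow> B r s \<and> C r s"
      if "r \<in> {1..n}" "s \<in> {1..n}" "r < s" for r s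
      unfolding B_def C_def using pair[OF that] rows[OF that(2)] \<open>\<forall>r\<in>{1..n}. A r\<close> that(2)
      unfolding A_def by blast
    then show ?thesis by meson
  qed
  have remC: "low_removal a b \<longleftrightarrow> (\<forall>r\<in>{1..n}. \<forall>s\<in>{1..n}. r < s \<longrightarrow> C r s)"
    unfolding C_def by (rule rem)
  have 1: "T \<in> SSKT_ge (Suc p) n b \<longleftrightarrow>
      (\<forall>r\<in>{1..n}. A r) \<and> (\<forall>r\<in>{1..n}. \<forall>s\<in>{1..n}. r < s \<longrightarrow> B r s)"
    using T by (simp add: SSKT_ge_def SSKT_iff A_def B_def)
  have 2: "?E \<in> SSKT_ge p n a \<longleftrightarrow> (\<forall>r\<in>{1..n}. A r) \<and>
      (\<forall>r\<in>{1..n}. \<forall>s\<in>{1..n}. r < s \<longrightarrow> key_pair (a r) (a s) (row_entry ?E r) (row_entry ?E s))"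
    unfolding SSKT_ge_def mem_Collect_eq SSKT_iff rowsA using fill bound by simp
  show ?thesis
    unfolding 1 2 remC by (cases "\<forall>r\<in>{1..n}. A r") (simp_all only: pairs simp_thms conj_assoc)
qed

lemma extend_reverse_SSAF_le:
  assumes q: "q \<in> {1..n}" and a: "\<And>r. r \<notin> {1..q} \<Longrightarrow> a r = 0" and ba: "\<And>r. b r \<le> a r"
    and T: "T \<in> fillings n b" "\<forall>u\<in>key_diagram n b. T u < q"
  shows "extend n a b q T \<in> reverse_SSAF_le q n a \<longleftrightarrow> T \<in> reverse_SSAF_le (q - 1) n b \<and> top_addition q b a"
proof -
  let ?E = "extend n a b q T"
  have E: "c \<le> b r \<Longrightarrow> row_entry ?E r c = row_entry T r c" "b r < c \<Longrightarrow> c \<le> a r \<Longrightarrow> row_entry ?E r c = q"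
    if "r \<in> {1..n}" for c r using row_entry_extend[of r n b a c q T] that ba by auto
  have small: "row_entry T r c < q" if "r \<in> {1..n}" "0 < c" "c \<le> b r" for r c
    using bspec[OF T(2), of "(c, r)"] that by (simp add: row_entry_pos mem_key_diagram)
  have rows: "(\<forall>c<a r. row_entry ?E r c \<le> row_entry ?E r (Suc c)) \<longleftrightarrow> (\<forall>c<b r. row_entry T r c \<le> row_entry T r (Suc c))"
    if r: "r \<in> {1..n}" for r
  proof
    assume *: "\<forall>c<a r. row_entry ?E r c \<le> row_entry ?E r (Suc c)"
    show "\<forall>c<b r. row_entry T r c \<le> row_entry T r (Suc c)"
    proof (intro allI impI)
      fix c assume "c < b r"
      then show "row_entry T r c \<le> row_entry T r (Suc c)"
        using *[rule_format, of c] E(1)[OF r, of c] E(1)[OF r, of "Suc c"] ba[of r] by simp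
    qed
  next
    assume *: "\<forall>c<b r. row_entry T r c \<le> row_entry T r (Suc c)"
    show "\<forall>c<a r. row_entry ?E r c \<le> row_entry ?E r (Suc c)"
    proof (intro allI impI)
      fix c assume c: "c < a r"
      then have "r \<le> q" using a[of r] by (cases "r \<le> q") auto
      consider "c < b r" | "c = b r" | "b r < c" by linarith
      then show "row_entry ?E r c \<le> row_entry ?E r (Suc c)"
      proof cases
        case 1
        then show ?thesis using *[rule_format, of c] E(1)[OF r, of c] E(1)[OF r, of "Suc c"] by simp
      next
        case 2
        have "row_entry T r c \<le> q" using small[OF r, of c] 2 \<open>r \<le> q\<close> by (cases "c = 0") auto
        then show ?thesis using E(1)[OF r, of c] E(2)[OF r, of "Suc c"] 2 c by simp
      next
        case 3
        then show ?thesis using E(2)[OF r, of c] E(2)[OF r, of "Suc c"] c by simp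
      qed
    qed
  qed
  have pair: "ssaf_pair (a r) (a s) (row_entry ?E r) (row_entry ?E s) \<longleftrightarrow>
      ssaf_pair (b r) (b s) (row_entry T r) (row_entry T s) \<and> (s \<le> q \<longrightarrow> b r < a r \<longrightarrow> a s < b r \<or> a r \<le> b s)"
    if rs: "r \<in> {1..n}" "s \<in> {1..n}" "r < s" and inc: "\<forall>c<a r. row_entry ?E r c \<le> row_entry ?E r (Suc c)" for r s
  \<comment> \<open>Row \<open>s\<close> is then empty and its basement entry exceeds all entries of
    the diagram, so the pair condition is automatic. This is why \<open>top_addition\<close>
    compares rows up to \<open>q\<close> only.\<close>
  proof (cases "q < s")
    case True
    then have 0: "a s = 0" "b s = 0" using a[of s] ba[of s] by auto
    have "row_entry ?E r (Suc 0) < s" if "0 < a r"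
      using E[OF rs(1), of "Suc 0"] small[OF rs(1), of "Suc 0"] that True by (cases "0 < b r") auto
    moreover have "row_entry T r (Suc 0) < s" if "0 < b r"
      using small[OF rs(1), of "Suc 0"] that True by auto
    ultimately show ?thesis using 0 True by (auto simp: ssaf_pair_def)
  next
    case False
    have "ssaf_pair (a r) (a s) (row_entry ?E r) (row_entry ?E s) \<longleftrightarrow>
      ssaf_pair (b r) (b s) (row_entry ?E r) (row_entry ?E s) \<and> (b r < a r \<longrightarrow> a s < b r \<or> a r \<le> b s)"
      by (rule ssaf_pair_addition[where q = q])
        (use ba rs E small inc False in auto)
    also have "ssaf_pair (b r) (b s) (row_entry ?E r) (row_entry ?E s) \<longleftrightarrow> ssaf_pair (b r) (b s) (row_entry T r) (row_entry T s)"
      by (rule ssaf_pair_cong) (use E rs in auto)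
    finally show ?thesis using False by simp
  qed
  have rem: "top_addition q b a \<longleftrightarrow> (\<forall>r\<in>{1..n}. \<forall>s\<in>{1..n}. r < s \<longrightarrow>
      s \<le> q \<longrightarrow> b r < a r \<longrightarrow> a s < b r \<or> a r \<le> b s)"
  proof -
    have "r \<in> {1..n} \<and> s \<in> {1..n}" if "r < s" "s \<le> q" "b r < a r" for r s
      using that a[of r] q by (cases "r \<in> {1..q}") auto
    moreover have "a r = b r" if "q < r" for r using a[of r] ba[of r] that by simp
    ultimately show ?thesis using ba unfolding top_addition_def by blast
  qed
  have fill: "?E \<in> fillings n a" using q T ba by (intro extend_fillings) auto
  have bound: "\<forall>u\<in>key_diagram n a. ?E u \<le> q" using T(2) by (auto simp: extend_def)
  have Tq: "\<forall>u\<in>key_diagram n b. T u \<le> q - 1" using T(2) by auto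
  define A where "A r \<longleftrightarrow> (\<forall>c<b r. row_entry T r c \<le> row_entry T r (Suc c))" for r
  define B where "B r s \<longleftrightarrow> ssaf_pair (b r) (b s) (row_entry T r) (row_entry T s)" for r s
  define C where "C r s \<longleftrightarrow> (s \<le> q \<longrightarrow> b r < a r \<longrightarrow> a s < b r \<or> a r \<le> b s)" for r s
  have rowsA: "(\<forall>r\<in>{1..n}. \<forall>c<a r. row_entry ?E r c \<le> row_entry ?E r (Suc c)) \<longleftrightarrow> (\<forall>r\<in>{1..n}. A r)"
    unfolding A_def using rows by blast
  have pairs: "(\<forall>r\<in>{1..n}. \<forall>s\<in>{1..n}. r < s \<longrightarrow> ssaf_pair (a r) (a s) (row_entry ?E r) (row_entry ?E s)) \<longleftrightarrow>
    (\<forall>r\<in>{1..n}. \<forall>s\<in>{1..n}. r < s \<longrightarrow> B r s) \<and> (\<forall>r\<in>{1..n}. \<forall>s\<in>{1..n}. r < s \<longrightarrow> C r s)"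
    if "\<forall>r\<in>{1..n}. A r"
  proof -
    have "ssaf_pair (a r) (a s) (row_entry ?E r) (row_entry ?E s) \<longleftrightarrow> B r s \<and> C r s"
      if "r \<in> {1..n}" "s \<in> {1..n}" "r < s" for r s
      unfolding B_def C_def using pair[OF that] rows[OF that(1)] \<open>\<forall>r\<in>{1..n}. A r\<close> that(1)
      unfolding A_def by blast
    then show ?thesis by meson
  qed
  have remC: "top_addition q b a \<longleftrightarrow> (\<forall>r\<in>{1..n}. \<forall>s\<in>{1..n}. r < s \<longrightarrow> C r s)"
    unfolding C_def by (rule rem)
  have 1: "T \<in> reverse_SSAF_le (q - 1) n b \<longleftrightarrow>
      (\<forall>r\<in>{1..n}. A r) \<and> (\<forall>r\<in>{1..n}. \<forall>s\<in>{1..n}. r < s \<longrightarrow> B r s)"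
    using T Tq by (simp add: reverse_SSAF_le_def reverse_SSAF_iff A_def B_def)
  have 2: "?E \<in> reverse_SSAF_le q n a \<longleftrightarrow> (\<forall>r\<in>{1..n}. A r) \<and>
      (\<forall>r\<in>{1..n}. \<forall>s\<in>{1..n}. r < s \<longrightarrow> ssaf_pair (a r) (a s) (row_entry ?E r) (row_entry ?E s))"
    unfolding reverse_SSAF_le_def mem_Collect_eq reverse_SSAF_iff rowsA using fill bound by simp
  show ?thesis
    unfolding 1 2 remC by (cases "\<forall>r\<in>{1..n}. A r") (simp_all only: pairs simp_thms conj_assoc)
qed

lemma row_entry_antimono:
  assumes "\<forall>c<m. row_entry T r (Suc c) \<le> row_entry T r c" "d \<le> c" "c \<le> m"
  shows "row_entry T r c \<le> row_entry T r d"
  using assms(2,3)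
proof (induction rule: dec_induct)
  case (step c)
  then have "row_entry T r (Suc c) \<le> row_entry T r c" using assms(1) by simp
  then show ?case using step by simp
qed simp

lemma row_entry_mono:
  assumes "\<forall>c<m. row_entry T r c \<le> row_entry T r (Suc c)" "d \<le> c" "c \<le> m"
  shows "row_entry T r d \<le> row_entry T r c"
  using assms(2,3)
proof (induction rule: dec_induct)
  case (step c)
  then have "row_entry T r c \<le> row_entry T r (Suc c)" using assms(1) by simp
  then show ?case using step by simp
qed simp

lemma SSKT_ge_row:
  assumes "T \<in> SSKT_ge p n a" "(c, r) \<in> key_diagram n a" "d \<le> c"
  shows "row_entry T r c \<le> row_entry T r d"
  by (rule row_entry_antimono[where m = "a r"]) (use assms in \<open>auto simp: SSKT_ge_def SSKT_iff mem_key_diagram\<close>)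

lemma reverse_SSAF_le_row:
  assumes "T \<in> reverse_SSAF_le q n a" "(c, r) \<in> key_diagram n a" "d \<le> c"
  shows "row_entry T r d \<le> row_entry T r c"
  by (rule row_entry_mono[where m = "a r"]) (use assms in \<open>auto simp: reverse_SSAF_le_def reverse_SSAF_iff mem_key_diagram\<close>)

section \<open>Boundary cases and the branching rule for key polynomials\<close>

lemma SSKT_ge_empty:
  assumes "r \<in> {1..n}" "r < p" "a r \<noteq> 0"
  shows "SSKT_ge p n a = {}"
proof -
  have c: "(1, r) \<in> key_diagram n a" using assms by (simp add: mem_key_diagram)
  have False if T: "T \<in> SSKT_ge p n a" for T
  proof -
    have "T (1, r) \<le> r" using SSKT_ge_row[OF T c, of 0] by (simp add: row_entry_pos)
    moreover have "p \<le> T (1, r)" using T c by (auto simp: SSKT_ge_def)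
    ultimately show False using assms by simp
  qed
  then show ?thesis by blast
qed

lemma reverse_SSAF_le_empty:
  assumes "r \<in> {1..n}" "q < r" "a r \<noteq> 0"
  shows "reverse_SSAF_le q n a = {}"
proof -
  have c: "(1, r) \<in> key_diagram n a" using assms by (simp add: mem_key_diagram)
  have False if T: "T \<in> reverse_SSAF_le q n a" for T
  proof -
    have "r \<le> T (1, r)" using reverse_SSAF_le_row[OF T c, of 0] by (simp add: row_entry_pos)
    moreover have "T (1, r) \<le> q" using T c by (auto simp: reverse_SSAF_le_def)
    ultimately show False using assms by simp
  qed
  then show ?thesis by blast
qed

lemma key_diagram_0 [simp]: "key_diagram n (\<lambda>_. 0) = {}"
  by (auto simp: key_diagram_def)

lemma SSKT_ge_0: "SSKT_ge p n (\<lambda>_. 0) = {\<lambda>_. undefined}"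
  unfolding SSKT_ge_def by (auto simp: SSKT_iff fillings_def key_pair_def)

lemma reverse_SSAF_le_0: "reverse_SSAF_le q n (\<lambda>_. 0) = {\<lambda>_. undefined}"
  unfolding reverse_SSAF_le_def by (auto simp: reverse_SSAF_iff fillings_def ssaf_pair_def)

lemma card_key_diagram: "card (key_diagram n a) = sum a {1..n}"
proof -
  have "key_diagram n a = (\<lambda>(r, c). (c, r)) ` (SIGMA r:{1..n}. {1..a r})"
    by (force simp: key_diagram_def)
  then have "card (key_diagram n a) = card (SIGMA r:{1..n}. {1..a r})"
    by (simp only:) (rule card_image, auto simp: inj_on_def)
  then show ?thesis by simp
qed

lemma sum_atMost_support:
  fixes a :: "nat \<Rightarrow> nat"
  assumes "\<And>r. r \<notin> {1..q} \<Longrightarrow> a r = 0" "q \<le> n"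
  shows "sum a {..n} = sum a {..q}" "sum a {1..n} = sum a {..q}"
proof -
  have "sum a {..n} = sum a {1..q}" "sum a {..q} = sum a {1..q}" "sum a {1..n} = sum a {1..q}"
    using assms by (intro sum.mono_neutral_right; auto)+
  then show "sum a {..n} = sum a {..q}" "sum a {1..n} = sum a {..q}" by simp_all
qed

lemma finite_SSKT_ge: "finite (SSKT_ge p n a)"
  by (rule finite_subset[OF _ finite_SSKT[of n a]]) (auto simp: SSKT_ge_def)

lemma finite_reverse_SSAF_le: "finite (reverse_SSAF_le p n a)"
  by (rule finite_subset[OF _ finite_reverse_SSAF[of n a]]) (auto simp: reverse_SSAF_le_def)

text \<open>Rows decrease, so the entries larger than \<open>p\<close> fill a key diagram
  \<open>b\<close>, and the entries \<open>p\<close> form the strip between \<open>b\<close> and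
  \<open>a\<close>.\<close>

lemma bij_betw_SSKT_ge:
  assumes p: "p \<in> {1..n}" and a: "\<And>r. r \<notin> {p..n} \<Longrightarrow> a r = 0"
  shows "bij_betw (\<lambda>(b, T). extend n a b p T) (SIGMA b:{b. low_removal a b}. SSKT_ge (Suc p) n b) (SSKT_ge p n a)"
proof (rule extend_bij)
  fix b T assume "b \<in> {b. low_removal a b}" "T \<in> SSKT_ge (Suc p) n b"
  moreover from this have "T \<in> fillings n b" "\<forall>u\<in>key_diagram n b. Suc p \<le> T u" "\<And>r. b r \<le> a r"
    by (auto simp: SSKT_ge_def SSKT_iff low_removal_def)
  ultimately show "T \<in> fillings n b \<and> (\<forall>u\<in>key_diagram n b. T u \<noteq> p) \<and> extend n a b p T \<in> SSKT_ge p n a"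
    using extend_SSKT_ge[OF p a, where b = b and T = T] by fastforce
next
  fix T assume T: "T \<in> SSKT_ge p n a"
  have "p < T (d, r)" if "(c, r) \<in> key_diagram n a" "p < T (c, r)" "0 < d" "d \<le> c" for c d r
    using SSKT_ge_row[OF T that(1,4)] that by (simp add: row_entry_pos)
  then obtain b where b: "\<And>r. b r \<le> a r" "key_diagram n b = {u \<in> key_diagram n a. p < T u}"
    using initial_subdiagram[of n a "\<lambda>u. p < T u"] by blast
  define T' where "T' = restrict T (key_diagram n b)"
  have "T u = p" if "u \<in> key_diagram n a" "u \<notin> key_diagram n b" for u
    using T that b(2) by (auto simp: SSKT_ge_def)
  then have T': "T' \<in> fillings n b" "T = extend n a b p T'"
    unfolding T'_def using extend_restrict[of T n a b p] T b(1) by (auto simp: SSKT_ge_def SSKT_iff)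
  have "\<forall>u\<in>key_diagram n b. Suc p \<le> T' u" using b(2) by (auto simp: T'_def)
  then have "T' \<in> SSKT_ge (Suc p) n b \<and> low_removal a b"
    using extend_SSKT_ge[OF p a b(1) T'(1)] T T'(2) by simp
  then show "\<exists>b\<in>{b. low_removal a b}. \<exists>T'\<in>SSKT_ge (Suc p) n b. T = extend n a b p T'"
    using T'(2) by blast
qed (use p a in \<open>auto simp: low_removal_def\<close>)

text \<open>The monomial is a product over cells, so that it factors along the splitting of the
  diagram into \<open>b\<close> and a strip.\<close>

definition key_gen :: "nat \<Rightarrow> nat \<Rightarrow> (nat \<Rightarrow> nat) \<Rightarrow> zpoly" where
  "key_gen p n a = (\<Sum>T\<in>SSKT_ge p n a. \<Prod>u\<in>key_diagram n a. X (T u))"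

lemma key_gen_zero: "r \<in> {1..n} \<Longrightarrow> r < p \<Longrightarrow> a r \<noteq> 0 \<Longrightarrow> key_gen p n a = 0"
  by (simp add: key_gen_def SSKT_ge_empty)

lemma key_gen_0: "key_gen p n (\<lambda>_. 0) = 1"
  by (simp add: key_gen_def SSKT_ge_0)

lemma finite_low_removal:
  assumes "\<And>r. r > q \<Longrightarrow> a r = 0"
  shows "finite {b. low_removal a b}"
proof (rule finite_subset)
  show "{b. low_removal a b} \<subseteq> {b. (\<forall>r\<le>q. b r \<le> a r) \<and> (\<forall>r>q. b r = a r)}"
  proof
    fix b assume "b \<in> {b. low_removal a b}"
    then have "b r \<le> a r" for r by (simp add: low_removal_def)
    then show "b \<in> {b. (\<forall>r\<le>q. b r \<le> a r) \<and> (\<forall>r>q. b r = a r)}" using assms by (auto, metis le_zero_eq)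
  qed
qed (rule finite_bounded_funs)

lemma key_gen_remove_sum:
  assumes p: "p \<in> {1..n}" and a: "\<And>r. r \<notin> {p..n} \<Longrightarrow> a r = 0"
  shows "key_gen p n a = remove_sum (X p) n (key_gen (Suc p) n) a"
proof -
  let ?R = "{b. low_removal a b}"
  have fin: "finite ?R" by (rule finite_low_removal[of n]) (use a in auto)
  have "key_gen p n a = (\<Sum>(b, T)\<in>(SIGMA b:?R. SSKT_ge (Suc p) n b). \<Prod>u\<in>key_diagram n a. X (extend n a b p T u))"
    unfolding key_gen_def
    by (subst sum.reindex_bij_betw[OF bij_betw_SSKT_ge[OF p a], symmetric]) (auto simp: case_prod_beta)
  also have "\<dots> = (\<Sum>b\<in>?R. \<Sum>T\<in>SSKT_ge (Suc p) n b. \<Prod>u\<in>key_diagram n a. X (extend n a b p T u))"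
    by (rule sum.Sigma[symmetric]) (auto simp: fin finite_SSKT_ge)
  also have "\<dots> = (\<Sum>b\<in>?R. X p ^ (sum a {..n} - sum b {..n}) * key_gen (Suc p) n b)"
  proof (rule sum.cong)
    fix b assume b: "b \<in> ?R"
    then have ba: "b r \<le> a r" for r by (simp add: low_removal_def)
    have sub: "key_diagram n b \<subseteq> key_diagram n a" by (rule key_diagram_mono) (rule ba)
    have b0: "r \<notin> {1..n} \<Longrightarrow> b r = 0" "r \<notin> {1..n} \<Longrightarrow> a r = 0" for r using a[of r] ba[of r] p by auto
    have "card (key_diagram n a - key_diagram n b) = sum a {..n} - sum b {..n}"
      using sub sum_atMost_support(2)[of n b n] sum_atMost_support(2)[of n a n] b0
      by (subst card_Diff_subset) (simp_all add: finite_key_diagram card_key_diagram)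
    then have "(\<Prod>u\<in>key_diagram n a. X (extend n a b p T u)) =
      X p ^ (sum a {..n} - sum b {..n}) * (\<Prod>u\<in>key_diagram n b. X (T u))" for T
      by (subst prod.subset_diff[OF sub finite_key_diagram]) (auto simp: extend_def intro!: arg_cong2[where f = "(*)"])
    then show "(\<Sum>T\<in>SSKT_ge (Suc p) n b. \<Prod>u\<in>key_diagram n a. X (extend n a b p T u)) =
      X p ^ (sum a {..n} - sum b {..n}) * key_gen (Suc p) n b"
      by (simp add: key_gen_def sum_distrib_left)
  qed simp
  finally show ?thesis by (simp add: remove_sum_def)
qed

text \<open>\<open>key_gen_remove_sum\<close> measures sizes over all \<open>n\<close> rows and
  \<open>sum_strips_remove_sum\<close> over the first \<open>q\<close>; this lemma connects
  them.\<close>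

lemma remove_sum_support:
  assumes "\<And>r. r \<notin> {1..q} \<Longrightarrow> a r = 0" "q \<le> n"
  shows "remove_sum x n f a = remove_sum x q f a"
proof -
  have "sum b {..n} = sum b {..q}" if "low_removal a b" for b
  proof -
    have "b r \<le> a r" for r using that by (simp add: low_removal_def)
    then have "b r = 0" if "r \<notin> {1..q}" for r using assms(1)[OF that] by (metis le_zero_eq)
    then show ?thesis by (rule sum_atMost_support) (use assms in auto)
  qed
  moreover have "sum a {..n} = sum a {..q}" by (rule sum_atMost_support) (use assms in auto)
  ultimately show ?thesis by (simp add: remove_sum_def)
qed

lemma key_poly_eq_key_gen: "key_poly n a = key_gen 1 n a"
proof -
  have T: "T u \<in> {1..n}" if "T \<in> SSKT n a" "u \<in> key_diagram n a" for T u
    using that by (auto simp: SSKT_def fillings_def)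
  have "SSKT_ge 1 n a = SSKT n a" using T by (auto simp: SSKT_ge_def)
  moreover have "x_pow n (wt n a T) = (\<Prod>u\<in>key_diagram n a. X (T u))" if "T \<in> SSKT n a" for T
  proof -
    have "(\<Prod>u\<in>key_diagram n a. X (T u)) = (\<Prod>i\<in>{1..n}. \<Prod>u\<in>{u \<in> key_diagram n a. T u = i}. X (T u))"
      using T[OF that] by (intro prod.group[symmetric] finite_key_diagram) auto
    also have "\<dots> = x_pow n (wt n a T)"
      unfolding x_pow_def wt_def by (intro prod.cong refl) simp
    finally show ?thesis by simp
  qed
  ultimately show ?thesis unfolding key_poly_def key_gen_def by simp
qed

section \<open>Counting reverse SSAFs by their largest entry\<close>

lemma extend_wt:
  assumes "\<And>r. b r \<le> a r" "\<forall>u\<in>key_diagram n b. T u < q"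
  shows "i \<noteq> q \<Longrightarrow> wt n a (extend n a b q T) i = wt n b T i"
    and "wt n a (extend n a b q T) q = sum a {1..n} - sum b {1..n}"
proof -
  have sub: "key_diagram n b \<subseteq> key_diagram n a" by (rule key_diagram_mono) (rule assms)
  show "wt n a (extend n a b q T) i = wt n b T i" if "i \<noteq> q"
  proof -
    have "{u \<in> key_diagram n a. extend n a b q T u = i} = {u \<in> key_diagram n b. T u = i}"
      using sub that by (auto simp: extend_def)
    then show ?thesis by (simp add: wt_def)
  qed
  have "{u \<in> key_diagram n a. extend n a b q T u = q} = key_diagram n a - key_diagram n b"
    using sub assms(2) by (auto simp: extend_def)
  then show "wt n a (extend n a b q T) q = sum a {1..n} - sum b {1..n}"
    using sub by (simp add: wt_def card_Diff_subset finite_key_diagram card_key_diagram)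
qed

definition reverse_SSAF_wt :: "nat \<Rightarrow> nat \<Rightarrow> (nat \<Rightarrow> nat) \<Rightarrow> (nat \<Rightarrow> nat) \<Rightarrow> (cell \<Rightarrow> nat) set" where
  "reverse_SSAF_wt q n \<beta> a = {T \<in> reverse_SSAF_le q n a. \<forall>i\<in>{1..q}. wt n a T i = \<beta> i}"

lemma finite_reverse_SSAF_wt: "finite (reverse_SSAF_wt q n \<beta> a)"
  by (simp add: reverse_SSAF_wt_def finite_reverse_SSAF_le)

text \<open>Rows increase, so the entries below \<open>q\<close> fill a key diagram
  \<open>b\<close>. The removed cells are those with entry \<open>q\<close>; hence the strip from
  \<open>b\<close> to \<open>a\<close> has size \<open>\<beta> q\<close>.\<close>

lemma bij_betw_reverse_SSAF_wt:
  assumes q: "q \<in> {1..n}" and a: "\<And>r. r \<notin> {1..q} \<Longrightarrow> a r = 0"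
  shows "bij_betw (\<lambda>(b, T). extend n a b q T)
    (SIGMA b:{b. a \<in> strips q (\<beta> q) b}. reverse_SSAF_wt (q - 1) n \<beta> b) (reverse_SSAF_wt q n \<beta> a)"
proof (rule extend_bij)
  have sums: "sum a {1..n} = sum a {..q}" "sum b {1..n} = sum b {..q}" if "\<And>r. b r \<le> a r" for b
  proof -
    have "b r = 0" if "r \<notin> {1..q}" for r using a[OF that] \<open>\<And>r. b r \<le> a r\<close> by (metis le_zero_eq)
    then show "sum b {1..n} = sum b {..q}" using q by (intro sum_atMost_support(2)) auto
    show "sum a {1..n} = sum a {..q}" using a q by (intro sum_atMost_support(2)) auto
  qed
  {
    fix b T assume b: "b \<in> {b. a \<in> strips q (\<beta> q) b}" and T: "T \<in> reverse_SSAF_wt (q - 1) n \<beta> b"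
    have ba: "b r \<le> a r" for r using b by (simp add: strips_def top_addition_def)
    have lt: "\<forall>u\<in>key_diagram n b. T u < q" using T q by (fastforce simp: reverse_SSAF_wt_def reverse_SSAF_le_def)
    have fill: "T \<in> fillings n b" using T by (auto simp: reverse_SSAF_wt_def reverse_SSAF_le_def reverse_SSAF_iff)
    have "extend n a b q T \<in> reverse_SSAF_le q n a"
      using extend_reverse_SSAF_le[OF q a ba fill lt] T b by (simp add: reverse_SSAF_wt_def strips_def)
    moreover have "wt n a (extend n a b q T) i = \<beta> i" if "i \<in> {1..q}" for i
    proof (cases "i = q")
      case True
      then show ?thesis using extend_wt(2)[of b a n T q, OF ba lt] b sums[OF ba] by (simp add: strips_def)
    next
      case False
      then show ?thesis using extend_wt(1)[of b a n T q i, OF ba lt] T that by (auto simp: reverse_SSAF_wt_def)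
    qed
    ultimately show "T \<in> fillings n b \<and> (\<forall>u\<in>key_diagram n b. T u \<noteq> q) \<and> extend n a b q T \<in> reverse_SSAF_wt q n \<beta> a"
      using fill lt by (auto simp: reverse_SSAF_wt_def)
  next
    fix T assume "T \<in> reverse_SSAF_wt q n \<beta> a"
    then have T: "T \<in> reverse_SSAF_le q n a" and wt: "\<And>i. i \<in> {1..q} \<Longrightarrow> wt n a T i = \<beta> i"
      by (auto simp: reverse_SSAF_wt_def)
    have "T (d, r) < q" if "(c, r) \<in> key_diagram n a" "T (c, r) < q" "0 < d" "d \<le> c" for c d r
      using reverse_SSAF_le_row[OF T that(1,4)] that by (simp add: row_entry_pos)
    then obtain b where b: "\<And>r. b r \<le> a r" "key_diagram n b = {u \<in> key_diagram n a. T u < q}"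
      using initial_subdiagram[of n a "\<lambda>u. T u < q"] by blast
    define T' where "T' = restrict T (key_diagram n b)"
    have "T u = q" if "u \<in> key_diagram n a" "u \<notin> key_diagram n b" for u
      using T that b(2) by (auto simp: reverse_SSAF_le_def order.order_iff_strict)
    then have T': "T' \<in> fillings n b" "T = extend n a b q T'"
      unfolding T'_def using extend_restrict[of T n a b q] T b(1) by (auto simp: reverse_SSAF_le_def reverse_SSAF_iff)
    have lt: "\<forall>u\<in>key_diagram n b. T' u < q" using b(2) by (auto simp: T'_def)
    then have 1: "T' \<in> reverse_SSAF_le (q - 1) n b" "top_addition q b a"
      using extend_reverse_SSAF_le[OF q a b(1) T'(1)] T T'(2) by simp_all
    have "wt n b T' i = \<beta> i" if "i \<in> {1..q - 1}" for i
      using extend_wt(1)[of b a n T' q i, OF b(1) lt] wt[of i] that T'(2) by fastforce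
    moreover have "sum a {..q} = sum b {..q} + \<beta> q"
    proof -
      have "sum a {..q} - sum b {..q} = \<beta> q"
        using extend_wt(2)[of b a n T' q, OF b(1) lt] wt[of q] q T'(2) sums[OF b(1)] by simp
      moreover have "sum b {..q} \<le> sum a {..q}" by (rule sum_mono) (rule b)
      ultimately show ?thesis by simp
    qed
    ultimately have "T' \<in> reverse_SSAF_wt (q - 1) n \<beta> b" "b \<in> {b. a \<in> strips q (\<beta> q) b}"
      using 1 by (simp_all add: reverse_SSAF_wt_def strips_def)
    then show "\<exists>b\<in>{b. a \<in> strips q (\<beta> q) b}. \<exists>T'\<in>reverse_SSAF_wt (q - 1) n \<beta> b. T = extend n a b q T'"
      using T'(2) by blast
  }
qed (use q a in \<open>auto simp: strips_def top_addition_def\<close>)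

lemma card_reverse_SSAF_wt:
  assumes q: "q \<in> {1..n}" and a: "\<And>r. r \<notin> {1..q} \<Longrightarrow> a r = 0"
  shows "card (reverse_SSAF_wt q n \<beta> a) = (\<Sum>b\<in>{b. a \<in> strips q (\<beta> q) b}. card (reverse_SSAF_wt (q - 1) n \<beta> b))"
proof -
  have "finite {b. a \<in> strips q (\<beta> q) b}"
  proof (rule finite_subset)
    show "{b. a \<in> strips q (\<beta> q) b} \<subseteq> {b. (\<forall>r\<le>q. b r \<le> a r) \<and> (\<forall>r>q. b r = a r)}"
      by (auto simp: strips_def top_addition_def)
  qed (rule finite_bounded_funs)
  then show ?thesis
    using bij_betw_same_card[OF bij_betw_reverse_SSAF_wt[of q n a \<beta>, OF q a]]
    by (simp add: card_SigmaI finite_reverse_SSAF_wt)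
qed

section \<open>The Pieri rule and the expansion\<close>

definition h_range :: "nat \<Rightarrow> nat \<Rightarrow> nat \<Rightarrow> zpoly" where
  "h_range k p q = (\<Sum>js\<in>{js. length js = k \<and> sorted js \<and> set js \<subseteq> {p..q}}. prod_list (map X js))"

lemma h_poly_eq_h_range: "h_poly k i = h_range k 1 i"
  by (simp add: h_poly_def h_range_def)

lemma h_range_0 [simp]: "h_range 0 p q = 1"
proof -
  have "{js. length js = 0 \<and> sorted js \<and> set js \<subseteq> {p..q}} = {[]}" by auto
  then show ?thesis by (simp add: h_range_def)
qed

lemma h_range_empty: "q < p \<Longrightarrow> h_range (Suc k) p q = 0"
proof -
  assume "q < p"
  then have "{js. length js = Suc k \<and> sorted js \<and> set js \<subseteq> {p..q}} = {}" by (auto simp: length_Suc_conv)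
  then show ?thesis by (simp only: h_range_def sum.empty)
qed

text \<open>A sorted index sequence in \<open>{p..q}\<close> either avoids \<open>p\<close> or
  begins with it.\<close>

lemma h_range_Suc:
  assumes "p \<le> q"
  shows "h_range (Suc k) p q = h_range (Suc k) (Suc p) q + X p * h_range k p q"
proof -
  let ?L = "\<lambda>k p. {js. length js = k \<and> sorted js \<and> set js \<subseteq> {p..q}}"
  have fin: "finite (?L k p)" for k p
    by (rule finite_subset[OF _ finite_lists_length_eq[of "{p..q}" k]]) auto
  have eq: "?L (Suc k) p = ?L (Suc k) (Suc p) \<union> Cons p ` ?L k p"
  proof (intro equalityI subsetI)
    fix js assume "js \<in> ?L (Suc k) p"
    then obtain i js' where js: "js = i # js'" "length js' = k" "sorted (i # js')" "set (i # js') \<subseteq> {p..q}"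
      by (auto simp: length_Suc_conv)
    show "js \<in> ?L (Suc k) (Suc p) \<union> Cons p ` ?L k p"
    proof (cases "i = p")
      case False
      then have "Suc p \<le> i" using js by auto
      then have "set js \<subseteq> {Suc p..q}" using js by fastforce
      then show ?thesis using js by auto
    qed (use js in auto)
  next
    fix js assume "js \<in> ?L (Suc k) (Suc p) \<union> Cons p ` ?L k p"
    then show "js \<in> ?L (Suc k) p" using assms by (fastforce simp: subset_iff)
  qed
  have "?L (Suc k) (Suc p) \<inter> Cons p ` ?L k p = {}" by auto
  then have "h_range (Suc k) p q =
    h_range (Suc k) (Suc p) q + (\<Sum>js\<in>Cons p ` ?L k p. prod_list (map X js))"
    unfolding h_range_def eq by (intro sum.union_disjoint) (use fin in auto)
  also have "(\<Sum>js\<in>Cons p ` ?L k p. prod_list (map X js)) = X p * h_range k p q"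
    unfolding h_range_def by (subst sum.reindex) (auto simp: sum_distrib_left)
  finally show ?thesis .
qed

text \<open>Row \<open>q\<close> is empty and comes last, so it blocks every other empty row before
  it: raising such a row \<open>r\<close> would require \<open>b q < 0\<close> or
  \<open>b r \<le> 0\<close>.\<close>

lemma top_addition_support:
  assumes "\<And>r. r \<notin> {p..<q} \<Longrightarrow> a r = 0" "top_addition q a b" "r \<notin> {p..q}" "r \<noteq> q"
  shows "b r = 0"
proof (cases "r < q")
  case True
  then have "a r = 0" "a q = 0" using assms by auto
  then show ?thesis using assms(2) True unfolding top_addition_def by (metis gr0I le_zero_eq not_less_zero order_refl)
next
  case False
  then show ?thesis using assms by (auto simp: top_addition_def)
qed

lemma strips_0: "strips q 0 a = {a}"
proof -
  have "b = a" if b: "top_addition q a b" "sum b {..q} = sum a {..q}" for b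
  proof -
    have ab: "a r \<le> b r" for r using b by (simp add: top_addition_def)
    have "b r = a r" for r
    proof (cases "r \<le> q")
      case True
      show ?thesis
      proof (rule ccontr)
        assume "b r \<noteq> a r"
        then have "a r < b r" using ab[of r] by simp
        then have "sum a {..q} < sum b {..q}" using True ab by (intro sum_strict_mono_ex1) auto
        then show False using b by simp
      qed
    qed (use b in \<open>simp add: top_addition_def\<close>)
    then show ?thesis by auto
  qed
  moreover have "top_addition q a a" by (simp add: top_addition_def)
  ultimately show ?thesis by (auto simp: strips_def)
qed

text \<open>Downward induction on \<open>p\<close>, with an inner induction on \<open>k\<close>.
  Splitting off the entries \<open>p\<close> makes \<open>sum_strips_remove_sum\<close> applicable;
  its two terms are evaluated by the hypotheses for \<open>Suc p\<close> and for \<open>k\<close>,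
  and they add up as in \<open>h_range_Suc\<close>.\<close>

lemma key_gen_pieri:
  assumes "1 \<le> q" "q \<le> n" "1 \<le> p" "p \<le> Suc q" "\<And>r. r \<notin> {p..<q} \<Longrightarrow> a r = 0"
  shows "(\<Sum>b\<in>strips q k a. key_gen p n b) = h_range k p q * key_gen p n a"
  using assms(3-5)
proof (induction "Suc q - p" arbitrary: p a k)
  case 0
  then have p: "p = Suc q" by simp
  then have "a = (\<lambda>_. 0)" using 0 by auto
  show ?case
  proof (cases k)
    case 0
    then show ?thesis by (simp add: strips_0)
  next
    case (Suc k')
    \<comment> \<open>All entries would have to exceed \<open>q\<close>, which is impossible in a
      nonempty row up to \<open>q\<close>. On the other side stands a complete homogeneous
      polynomial of positive degree in no variables.\<close>
    have "key_gen p n b = 0" if b: "b \<in> strips q k a" for b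
    proof -
      have "sum b {..q} \<noteq> 0" using b Suc by (simp add: strips_def)
      then obtain r where r: "r \<le> q" "b r \<noteq> 0" by (auto simp: sum_eq_0_iff)
      have "r \<in> {1..q}"
        using top_addition_support[of 1 q a b r] b r \<open>a = _\<close> assms(1) by (auto simp: strips_def)
      then show ?thesis using r p assms by (intro key_gen_zero[of r]) auto
    qed
    then show ?thesis by (simp add: Suc h_range_empty p)
  qed
next
  case (Suc d)
  have pq: "p \<le> q" and pn: "p \<in> {1..n}" using Suc assms by auto
  have supp: "b r = 0" if "b \<in> strips q k a" "r \<notin> {p..q}" for k b r
    using top_addition_support[of p q a b r] that Suc.prems(3) pq by (cases "r = q") (auto simp: strips_def)
  have rem: "remove_sum (X p) q (key_gen (Suc p) n) b = key_gen p n b"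
    if "\<And>r. r \<notin> {p..q} \<Longrightarrow> b r = 0" for b
  proof -
    have "r \<notin> {1..q} \<Longrightarrow> b r = 0" "r \<notin> {p..n} \<Longrightarrow> b r = 0" for r
      using that[of r] Suc.prems assms by auto
    then show ?thesis
      using key_gen_remove_sum[OF pn, of b] remove_sum_support[of q b n] assms(2) by metis
  qed
  show ?case
  proof (induction k)
    case 0
    then show ?case by (simp add: strips_0)
  next
    case (Suc k)
    have a0: "a q = 0" "\<forall>r>q. a r = 0" using Suc.prems \<open>\<And>r. r \<notin> {p..<q} \<Longrightarrow> a r = 0\<close> by auto
    have "(\<Sum>b\<in>strips q (Suc k) a. key_gen p n b) =
      (\<Sum>b\<in>strips q (Suc k) a. remove_sum (X p) q (key_gen (Suc p) n) b)"
      by (intro sum.cong refl rem[symmetric]) (use supp in auto)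
    also have "\<dots> = remove_sum (X p) q (\<lambda>b. \<Sum>c\<in>strips q (Suc k) b. key_gen (Suc p) n c) a
      + X p * (\<Sum>b\<in>strips q k a. remove_sum (X p) q (key_gen (Suc p) n) b)"
      by (rule sum_strips_remove_sum) (use a0 in auto)
    also have "(\<Sum>b\<in>strips q k a. remove_sum (X p) q (key_gen (Suc p) n) b) = h_range k p q * key_gen p n a"
      unfolding Suc.IH[symmetric] by (intro sum.cong refl rem) (use supp in auto)
    also have "remove_sum (X p) q (\<lambda>b. \<Sum>c\<in>strips q (Suc k) b. key_gen (Suc p) n c) a =
      remove_sum (X p) q (\<lambda>b. h_range (Suc k) (Suc p) q * key_gen (Suc p) n b) a"
      unfolding remove_sum_def
    proof (intro sum.cong refl arg_cong2[where f = "(*)"])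
      fix b assume "b \<in> {b. low_removal a b}"
      then have ba: "b r \<le> a r" for r by (simp add: low_removal_def)
      show "(\<Sum>c\<in>strips q (Suc k) b. key_gen (Suc p) n c) = h_range (Suc k) (Suc p) q * key_gen (Suc p) n b"
      \<comment> \<open>The hypothesis for \<open>Suc p\<close> needs an empty row \<open>p\<close>.
        A nonempty row \<open>p\<close> of \<open>b\<close> stays nonempty after adding a strip, and
        then both sides vanish because no SSKT with entries above \<open>p\<close> has such a
        row.\<close>
      proof (cases "b p = 0")
        case True
        have "b r = 0" if "r \<notin> {Suc p..<q}" for r
          using True ba[of r] \<open>\<And>r. r \<notin> {p..<q} \<Longrightarrow> a r = 0\<close>[of r] that by (cases "r = p") auto
        then show ?thesis using \<open>Suc d = Suc q - p\<close> pq by (intro Suc.hyps(1)) auto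
      next
        case False
        have "key_gen (Suc p) n c = 0" if "c \<in> strips q (Suc k) b" for c
        proof -
          have "b p \<le> c p" using that by (simp add: strips_def top_addition_def)
          then show ?thesis using False pn by (intro key_gen_zero[of p]) auto
        qed
        moreover have "key_gen (Suc p) n b = 0" using False pn by (intro key_gen_zero[of p]) auto
        ultimately show ?thesis by simp
      qed
    qed
    also have "\<dots> = h_range (Suc k) (Suc p) q * remove_sum (X p) q (key_gen (Suc p) n) a"
      by (simp add: remove_sum_def sum_distrib_left mult_ac)
    also have "remove_sum (X p) q (key_gen (Suc p) n) a = key_gen p n a"
      by (rule rem) (use \<open>\<And>r. r \<notin> {p..<q} \<Longrightarrow> a r = 0\<close> in auto)
    finally show ?case by (simp add: h_range_Suc[OF pq] algebra_simps)
  qed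
qed

section \<open>Expansion of the flagged product\<close>

definition comps_of_size :: "nat \<Rightarrow> nat \<Rightarrow> (nat \<Rightarrow> nat) set" where
  "comps_of_size q m = {a \<in> weak_compositions q. sum a {..q} = m}"

lemma finite_comps_of_size: "finite (comps_of_size q m)"
proof (rule finite_subset)
  show "comps_of_size q m \<subseteq> {a. (\<forall>r\<le>q. a r \<le> m) \<and> (\<forall>r>q. a r = 0)}"
    using part_le_sum by (fastforce simp: comps_of_size_def weak_compositions_def)
qed (rule finite_bounded_funs)

text \<open>The Pieri rule multiplies by one factor at a time, adding a strip of size
  \<open>\<beta> q\<close> to shapes with empty row \<open>q\<close>. After exchanging the sums, the
  coefficient of \<open>key_gen 1 n a\<close> satisfies the recursion
  \<open>card_reverse_SSAF_wt\<close>. Fixing the size of the shapes keeps all sums finite.\<close>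

lemma prod_h_poly_eq:
  assumes "q \<le> n"
  shows "(\<Prod>i\<in>{1..q}. h_poly (\<beta> i) i) =
    (\<Sum>a\<in>comps_of_size q (sum \<beta> {1..q}). of_nat (card (reverse_SSAF_wt q n \<beta> a)) * key_gen 1 n a)"
  using assms
proof (induction q)
  case 0
  have "comps_of_size 0 0 = {\<lambda>_. 0}" by (auto simp: comps_of_size_def weak_compositions_def)
  moreover have "reverse_SSAF_wt 0 n \<beta> (\<lambda>_. 0) = {\<lambda>_. undefined}" by (simp add: reverse_SSAF_wt_def reverse_SSAF_le_0)
  ultimately show ?case by (simp add: key_gen_0)
next
  case (Suc p)
  define q where "q = Suc p"
  have q: "q \<in> {1..n}" using Suc.prems by (simp add: q_def)
  let ?A = "comps_of_size p (sum \<beta> {1..p})" and ?B = "comps_of_size q (sum \<beta> {1..q})"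
  let ?N = "\<lambda>q a. of_nat (card (reverse_SSAF_wt q n \<beta> a)) :: zpoly"
  have A: "b r = 0" if "b \<in> ?A" "r \<notin> {1..<q}" for b r
    using that by (auto simp: comps_of_size_def weak_compositions_def q_def)
  have sum_q: "sum b {..q} = sum b {..p}" if "b q = 0" for b :: "nat \<Rightarrow> nat"
    using that by (simp add: q_def)
  have sum_\<beta>: "sum \<beta> {1..q} = sum \<beta> {1..p} + \<beta> q" by (simp add: q_def)
  have AB: "strips q (\<beta> q) b = {a \<in> ?B. a \<in> strips q (\<beta> q) b}" if b: "b \<in> ?A" for b
  proof -
    have "a \<in> ?B" if a: "a \<in> strips q (\<beta> q) b" for a
    proof -
      have "a r = 0" if "r \<notin> {1..q}" for r
        by (rule top_addition_support[of 1 q b a r]) (use A[OF b] a that q in \<open>auto simp: strips_def\<close>)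
      moreover have "sum a {..q} = sum \<beta> {1..q}"
        using a b sum_q[of b, OF A[OF b]] sum_\<beta> by (simp add: strips_def comps_of_size_def)
      ultimately show ?thesis by (simp add: comps_of_size_def weak_compositions_def)
    qed
    then show ?thesis by blast
  qed
  have "(\<Prod>i\<in>{1..q}. h_poly (\<beta> i) i) = h_poly (\<beta> q) q * (\<Sum>b\<in>?A. ?N p b * key_gen 1 n b)"
    using Suc by (simp add: q_def mult.commute)
  also have "\<dots> = (\<Sum>b\<in>?A. \<Sum>a\<in>strips q (\<beta> q) b. ?N p b * key_gen 1 n a)"
    unfolding sum_distrib_left
  proof (intro sum.cong refl)
    fix b assume b: "b \<in> ?A"
    have pieri: "(\<Sum>a\<in>strips q (\<beta> q) b. key_gen 1 n a) = h_poly (\<beta> q) q * key_gen 1 n b"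
      unfolding h_poly_eq_h_range by (rule key_gen_pieri) (use q A[OF b] in auto)
    show "h_poly (\<beta> q) q * (?N p b * key_gen 1 n b) = (\<Sum>a\<in>strips q (\<beta> q) b. ?N p b * key_gen 1 n a)"
      unfolding sum_distrib_left[symmetric] pieri by (rule mult.left_commute)
  qed
  also have "\<dots> = (\<Sum>b\<in>?A. \<Sum>a\<in>{a \<in> ?B. a \<in> strips q (\<beta> q) b}. ?N p b * key_gen 1 n a)"
    using AB by (intro sum.cong) auto
  also have "\<dots> = (\<Sum>a\<in>?B. \<Sum>b\<in>{b \<in> ?A. a \<in> strips q (\<beta> q) b}. ?N p b * key_gen 1 n a)"
    by (rule sum.swap_restrict) (rule finite_comps_of_size)+
  also have "\<dots> = (\<Sum>a\<in>?B. ?N q a * key_gen 1 n a)"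
  proof (rule sum.cong)
    fix a assume a: "a \<in> ?B"
    then have a0: "a r = 0" if "r \<notin> {1..q}" for r
      using that by (auto simp: comps_of_size_def weak_compositions_def)
    \<comment> \<open>The recursion runs over all \<open>b\<close> with a strip to \<open>a\<close>,
      the Pieri rule only over those in \<open>?A\<close>. By support and size, the others have a
      nonempty row \<open>q\<close>, and so admit no reverse SSAF with entries at most
      \<open>p\<close>.\<close>
    have "(\<Sum>b\<in>{b \<in> ?A. a \<in> strips q (\<beta> q) b}. card (reverse_SSAF_wt p n \<beta> b)) =
      (\<Sum>b\<in>{b. a \<in> strips q (\<beta> q) b}. card (reverse_SSAF_wt p n \<beta> b))"
    proof (rule sum.mono_neutral_left)
      show "finite {b. a \<in> strips q (\<beta> q) b}"
        by (rule finite_subset[OF _ finite_bounded_funs[of q a a]]) (auto simp: strips_def top_addition_def)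
      show "\<forall>b\<in>{b. a \<in> strips q (\<beta> q) b} - {b \<in> ?A. a \<in> strips q (\<beta> q) b}. card (reverse_SSAF_wt p n \<beta> b) = 0"
      proof
        fix b assume b: "b \<in> {b. a \<in> strips q (\<beta> q) b} - {b \<in> ?A. a \<in> strips q (\<beta> q) b}"
        have ba: "b r \<le> a r" for r using b by (simp add: strips_def top_addition_def)
        have "b q \<noteq> 0"
        proof
          assume bq: "b q = 0"
          have "b r = 0" if "r \<notin> {1..p}" for r
            using a0[of r] ba[of r] bq that by (cases "r = q") (auto simp: q_def)
          moreover have "sum b {..p} = sum \<beta> {1..p}"
            using b a sum_q[of b, OF bq] sum_\<beta> by (simp add: strips_def comps_of_size_def)
          ultimately show False using b by (simp add: comps_of_size_def weak_compositions_def)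
        qed
        then show "card (reverse_SSAF_wt p n \<beta> b) = 0"
          using reverse_SSAF_le_empty[of q n p b] q by (simp add: reverse_SSAF_wt_def q_def)
      qed
    qed auto
    also have "\<dots> = card (reverse_SSAF_wt q n \<beta> a)"
      using card_reverse_SSAF_wt[of q n a \<beta>, OF q a0] by (simp add: q_def)
    finally have "(\<Sum>b\<in>{b \<in> ?A. a \<in> strips q (\<beta> q) b}. ?N p b) = ?N q a"
      unfolding of_nat_sum[symmetric] by simp
    then show "(\<Sum>b\<in>{b \<in> ?A. a \<in> strips q (\<beta> q) b}. ?N p b * key_gen 1 n a) = ?N q a * key_gen 1 n a"
      by (simp only: sum_distrib_right[symmetric])
  qed simp
  finally show ?case by (simp only: q_def)
qed

lemma K_tilde_eq_card:
  assumes "b \<in> weak_compositions n"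
  shows "K_tilde n a b = card (reverse_SSAF_wt n n b a)"
proof -
  have T: "T u \<in> {1..n}" if "T \<in> reverse_SSAF n a" "u \<in> key_diagram n a" for T u
    using that by (auto simp: reverse_SSAF_def fillings_def)
  have "wt n a T i = b i" if "T \<in> reverse_SSAF n a" "i \<notin> {1..n}" for T i
  proof -
    have "{u \<in> key_diagram n a. T u = i} = {}" using T[OF that(1)] that(2) by auto
    then have "wt n a T i = 0" by (simp only: wt_def card.empty)
    then show ?thesis using assms that(2) by (simp add: weak_compositions_def)
  qed
  then have "{T \<in> reverse_SSAF n a. wt n a T = b} = reverse_SSAF_wt n n b a"
    using T by (fastforce simp: reverse_SSAF_wt_def reverse_SSAF_le_def fun_eq_iff)
  then show ?thesis by (simp add: K_tilde_def)
qed

text \<open>Each cell is counted once by its entry, so shape and weight have equal size. This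
  confines the sum in the theorem to a finite set of shapes.\<close>

lemma K_tilde_size:
  assumes "K_tilde n a b \<noteq> 0"
  shows "sum a {1..n} = sum b {1..n}"
proof -
  obtain T where T: "T \<in> reverse_SSAF n a" "wt n a T = b"
    using assms by (auto simp: K_tilde_def card_eq_0_iff)
  have "T u \<in> {1..n}" if "u \<in> key_diagram n a" for u
    using that T(1) by (auto simp: reverse_SSAF_def fillings_def)
  then have "(\<Sum>i\<in>{1..n}. \<Sum>u\<in>{u \<in> key_diagram n a. T u = i}. 1) = (\<Sum>u\<in>key_diagram n a. 1::nat)"
    by (intro sum.group finite_key_diagram) auto
  then show ?thesis using T(2) card_key_diagram[of n a] by (auto simp: wt_def)
qed

theorem theorem4p12:
  fixes n :: nat and b :: "nat \<Rightarrow> nat"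
  assumes "n \<ge> 1" and "b \<in> weak_compositions n"
  shows "finite {a \<in> weak_compositions n. K_tilde n a b \<noteq> 0} \<and>
    flagged_h n b =
      (\<Sum>a\<in>{a \<in> weak_compositions n. K_tilde n a b \<noteq> 0}. of_nat (K_tilde n a b) * key_poly n a)"
proof -
  let ?S = "{a \<in> weak_compositions n. K_tilde n a b \<noteq> 0}" and ?A = "comps_of_size n (sum b {1..n})"
  have sub: "?S \<subseteq> ?A"
  proof
    fix a assume a: "a \<in> ?S"
    then have "sum a {..n} = sum a {1..n}"
      by (intro sum_atMost_support(2)[symmetric]) (auto simp: weak_compositions_def)
    then show "a \<in> ?A" using a K_tilde_size by (auto simp: comps_of_size_def)
  qed
  have "flagged_h n b = (\<Sum>a\<in>?A. of_nat (K_tilde n a b) * key_poly n a)"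
    using prod_h_poly_eq[of n n b] assms(2)
    by (simp add: flagged_h_def K_tilde_eq_card key_poly_eq_key_gen)
  also have "\<dots> = (\<Sum>a\<in>?S. of_nat (K_tilde n a b) * key_poly n a)"
    by (rule sum.mono_neutral_right) (use sub finite_comps_of_size in \<open>auto simp: comps_of_size_def\<close>)
  finally show ?thesis using finite_subset[OF sub finite_comps_of_size] by simp
qed

end
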